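(* Let $w_0:[0,\infty)\to[0,\infty)$ be a decreasing integrable function with $\int_0^\infty w_0(x)\,dx=1$, which is initial data for the LSW system and satisfies $L(0)=1$. Let $X_0$ be the random variable associated with $w_0$ and $\beta_0(\cdot)$ its beta function. Let $w(x,t)$, $x\ge0$, $t\ge0$, be the solution of the LSW system with initial data $w_0$. Assume that $\sup\beta_0(\cdot)<\infty$ and that the limit $\lim_{x\to\|X_0\|_\infty}\beta_0(x)$ exists and is positive. Then there is a constant $C>0$, depending only on the function $\beta_0(\cdot)$, such that $$\Lambda(T)\ge CT,\qquad T\ge1 .$$
   Context: Beta function. For a nonnegative decreasing integrable function $w$ on $[0,\infty)$ (not identically zero) let $X$ be the associated positive random variable, with $P(X>x)=w(x)/w(0)$, let $\|X\|_\infty\in(0,\infty]$ be its essential supremum, and let $h(x)=\int_x^\infty w(x')\,dx'$. Assuming $h$ is $C^2$ on $[0,\|X\|_\infty)$, the beta function of $w$ (or of $X$) is $\beta(x)=h''(x)h(x)/h'(x)^2$, $0\le x<\|X\|_\infty$. Beta functions are assumed to exist in this sense whenever mentioned. LSW system. It consists of $$\frac{\partial w(x,t)}{\partial t}=\left[1-\left\{\frac{x}{L(t)}\right\}^{1/3}\right]\frac{\partial w}{\partial x}(x,t),\quad x>0,\ t>0,\qquad \int_0^\infty w(x,t)\,dx=1,$$ with $w(x,0)=w_0(x)$; the function $L(t)>0$ is determined by the integral constraint and is given by $L(t)^{1/3}=\frac13\int_0^\infty x^{-2/3}w(x,t)\,dx\,/\,w(0,t)$ (also at $t=0$ with $w(\cdot,0)=w_0$).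 Solutions are understood via characteristics: $L$ is continuous and positive and $w(x,t)=w_0(F(x,t))$, where $F(x,t)=x(0)$ and $x(s)$, $0\le s\le t$, solves $dx/ds=-[1-\{x/L(s)\}^{1/3}]$, $x(t)=x$. With $c(\cdot,t)=-\partial w(\cdot,t)/\partial x$, the mean cluster volume is $\Lambda(t)=\int_0^\infty x\,c(x,t)\,dx\big/\int_0^\infty c(x,t)\,dx=1/w(0,t)$. *)

theory Defs
  imports "HOL-Probability.Probability"
begin

text \<open>Functions on \<open>[0,\<infinity>)\<close> are represented by total functions on the reals of which only
  the values at nonnegative arguments matter.\<close>

text \<open>The random variable \<open>X\<close> associated with \<open>w\<close> enters through its distribution \<open>\<mu>\<close>,
  i.e. as the identity on the probability space \<open>\<mu>\<close>. Taking \<open>x = 0\<close> with \<open>w 0 \<noteq> 0\<close> gives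
  \<open>P(X > 0) = 1\<close>. The tail identity forces \<open>w\<close> to be right-continuous.\<close>

definition associated_law :: "(real \<Rightarrow> real) \<Rightarrow> real measure \<Rightarrow> bool" where
  "associated_law w \<mu> \<longleftrightarrow> real_distribution \<mu> \<and> (\<forall>x\<ge>0. measure \<mu> {x<..} = w x / w 0)"

definition sup_norm :: "real measure \<Rightarrow> ereal" where
  "sup_norm \<mu> = esssup \<mu> ereal"

definition tail_int :: "(real \<Rightarrow> real) \<Rightarrow> real \<Rightarrow> real" where
  "tail_int w x = (LBINT y:{x..}. w y)"

definition beta_dom :: "ereal \<Rightarrow> real set" where
  "beta_dom b = {x. 0 \<le> x \<and> ereal x < b}"

text \<open>Derivatives are taken relative to \<open>[0,b)\<close>, so they are one-sided at \<open>0\<close>. They are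
  unique there when \<open>b > 0\<close>, hence \<open>\<beta>\<close> is determined on \<open>[0,b)\<close> by \<open>w\<close>.\<close>

definition is_beta_function :: "(real \<Rightarrow> real) \<Rightarrow> ereal \<Rightarrow> (real \<Rightarrow> real) \<Rightarrow> bool" where
  "is_beta_function w b \<beta> \<longleftrightarrow> (\<exists>h' h''.
     (\<forall>x\<in>beta_dom b.
        (tail_int w has_real_derivative h' x) (at x within beta_dom b) \<and>
        (h' has_real_derivative h'' x) (at x within beta_dom b)) \<and>
     continuous_on (beta_dom b) h'' \<and>
     (\<forall>x\<in>beta_dom b. \<beta> x = h'' x * tail_int w x / (h' x)\<^sup>2))"

definition lsw_initial_data :: "(real \<Rightarrow> real) \<Rightarrow> bool" where
  "lsw_initial_data w\<^sub>0 \<longleftrightarrow>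
     (\<forall>x\<ge>0. w\<^sub>0 x \<ge> 0) \<and> antimono_on {0..} w\<^sub>0 \<and>
     set_integrable lborel {0..} w\<^sub>0 \<and> (LBINT x:{0..}. w\<^sub>0 x) = 1"

definition lsw_characteristic ::
  "(real \<Rightarrow> real) \<Rightarrow> real \<Rightarrow> real \<Rightarrow> (real \<Rightarrow> real) \<Rightarrow> bool" where
  "lsw_characteristic L x t \<xi> \<longleftrightarrow> \<xi> t = x \<and>
     (\<forall>s\<in>{0..t}. 0 \<le> \<xi> s \<and>
        (\<xi> has_real_derivative - (1 - root 3 (\<xi> s / L s))) (at s within {0..t}))"

text \<open>A characteristic ending in \<open>(x,t)\<close> is unique: run backwards in time its velocity
  \<open>1 - (\<xi>/L)\<^bsup>1/3\<^esup>\<close> is decreasing in \<open>\<xi>\<close>. Hence \<open>\<xi> 0\<close> below is the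
  backward flow \<open>F(x,t)\<close>.\<close>

definition lsw_solution ::
  "(real \<Rightarrow> real) \<Rightarrow> (real \<Rightarrow> real \<Rightarrow> real) \<Rightarrow> (real \<Rightarrow> real) \<Rightarrow> bool" where
  "lsw_solution w\<^sub>0 w L \<longleftrightarrow>
     continuous_on {0..} L \<and> (\<forall>t\<ge>0. L t > 0) \<and>
     (\<forall>t\<ge>0. \<forall>x\<ge>0. \<exists>\<xi>. lsw_characteristic L x t \<xi> \<and> w x t = w\<^sub>0 (\<xi> 0)) \<and>
     (\<forall>t\<ge>0. set_integrable lborel {0..} (\<lambda>x. w x t) \<and> (LBINT x:{0..}. w x t) = 1) \<and>
     (\<forall>t\<ge>0. root 3 (L t) = (1/3) * (LBINT x:{0<..}. x powr (-2/3) * w x t) / w 0 t)"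

definition cluster_density :: "(real \<Rightarrow> real \<Rightarrow> real) \<Rightarrow> real \<Rightarrow> real \<Rightarrow> real" where
  "cluster_density w x t = - deriv (\<lambda>y. w y t) x"

definition mean_volume :: "(real \<Rightarrow> real \<Rightarrow> real) \<Rightarrow> real \<Rightarrow> real" where
  "mean_volume w t =
     (LBINT x:{0<..}. x * cluster_density w x t) / (LBINT x:{0<..}. cluster_density w x t)"

end

theory Submission
  imports Defs
begin

text \<open>Let \<open>F x t\<close> be the backward flow, \<open>h\<close> the tail integral of \<open>w\<^sub>0\<close> and \<open>\<Lambda> t = 1 / w 0 t\<close>, which
  is the mean volume. Put \<open>z\<^bsub>j+1\<^esub> = z\<^bsub>j\<^esub> + h(z\<^bsub>j\<^esub>) / (2 w\<^sub>0(z\<^bsub>j\<^esub>))\<close>. The upper bound on \<open>\<beta>\<^sub>0\<close> bounds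
  \<open>w\<^sub>0(z\<^bsub>j+1\<^esub>) / w\<^sub>0(z\<^bsub>j\<^esub>)\<close> away from 0, and the positive limit of \<open>\<beta>\<^sub>0\<close> bounds it away from 1 once \<open>z\<^sub>0\<close>
  is close to the end point. So \<open>\<Lambda>\<close> grows geometrically along the times \<open>T\<^bsub>j\<^esub>\<close> at which the
  characteristic of \<open>z\<^bsub>j\<^esub>\<close> is absorbed at 0, and linear growth follows from
  \<open>T\<^bsub>j+1\<^esub> - T\<^bsub>j\<^esub> \<le> C \<Lambda>(T\<^bsub>j\<^esub>)\<close>. Once the characteristics of \<open>z\<^bsub>j+1\<^esub>\<close> and \<open>z\<^bsub>j+2\<^esub>\<close> are a distance of
  order \<open>\<Lambda>\<close> apart at time \<open>T\<^bsub>j\<^esub>\<close>, this holds because gaps expand at a rate of order \<open>1/\<Lambda>\<close> and live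
  particles have size at most of order \<open>\<Lambda>\<close>. The separation comes from bounded distortion: until
  \<open>T\<^bsub>j-1\<^esub>\<close> because the flow increases cross ratios (the velocity has positive third derivative, so
  the interval below \<open>z\<^bsub>j\<^esub>\<close> is Koebe space), and from \<open>T\<^bsub>j-1\<^esub>\<close> to \<open>T\<^bsub>j\<^esub>\<close> because by conservation of mass
  the characteristic of \<open>z\<^bsub>j+1\<^esub>\<close> stays at distance of order \<open>\<Lambda>\<close> from the singularity 0 of the velocity.\<close>

section \<open>Gaps between characteristics\<close>

text \<open>Derivatives are taken relative to a larger \<open>S\<close>: characteristics are
  differentiable relative to \<open>{0..t}\<close> and the data relative to \<open>[0,b)\<close>,
  while monotonicity is wanted on subintervals.\<close>

lemma nondecreasing_if_deriv_nonneg: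
  fixes f f' :: "real \<Rightarrow> real"
  assumes "a \<le> b" "{a..b} \<subseteq> S"
    and "\<And>s. s \<in> {a..b} \<Longrightarrow> (f has_real_derivative f' s) (at s within S)"
    and "\<And>s. a < s \<Longrightarrow> s < b \<Longrightarrow> f' s \<ge> 0"
  shows "f a \<le> f b"
proof -
  have d: "(f has_real_derivative f' s) (at s within {a..b})" if "s \<in> {a..b}" for s
    using assms(2,3) that has_field_derivative_subset by blast
  have "continuous_on {a..b} f"
    using DERIV_continuous_on d by blast
  moreover have "\<exists>y. DERIV f s :> y \<and> y \<ge> 0" if "a < s" "s < b" for s
    using d[of s] assms(4)[of s] that by (auto simp: at_within_Icc_at)
  ultimately show ?thesis
    using DERIV_nonneg_imp_increasing_open[OF assms(1)] by blast
qed

section \<open>The divided difference of the cube root\<close>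

lemma cube_denominator_pos:
  fixes a b :: real
  assumes "0 \<le> a" "0 < b"
  shows "0 < a\<^sup>2 + a * b + b\<^sup>2"
  using assms by (intro add_nonneg_pos add_nonneg_nonneg mult_nonneg_nonneg) auto

text \<open>The divided difference of the cube root, in a form that also makes sense on the diagonal
  away from 0. Divided by \<open>root 3 (L s)\<close> it is the logarithmic growth rate of the gap
  between characteristics at \<open>x\<close> and \<open>y\<close>.\<close>

definition kern :: "real \<Rightarrow> real \<Rightarrow> real" where
  "kern x y = 1 / ((root 3 x)\<^sup>2 + root 3 x * root 3 y + (root 3 y)\<^sup>2)"

lemma kern_commute: "kern x y = kern y x"
  by (simp add: kern_def algebra_simps)

lemma root3_cube: "root 3 x ^ 3 = x"
  using odd_real_root_pow[of 3 x] by simp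

lemma root3_diff:
  assumes "0 \<le> x" "x < y"
  shows "root 3 y - root 3 x = kern x y * (y - x)"
proof -
  define a b where "a = root 3 x" and "b = root 3 y"
  have "0 \<le> a" "a < b" using assms by (auto simp: a_def b_def)
  then have pos: "a\<^sup>2 + a*b + b\<^sup>2 > 0" by (intro cube_denominator_pos) auto
  have "y - x = b^3 - a^3" by (simp add: a_def b_def root3_cube)
  also have "\<dots> = (b - a) * (a\<^sup>2 + a*b + b\<^sup>2)" by algebra
  finally show ?thesis using pos by (simp add: kern_def a_def[symmetric] b_def[symmetric])
qed

section \<open>Order and spacing of characteristics\<close>

lemma characteristic_restrict:
  assumes "lsw_characteristic L x t \<xi>" "s \<in> {0..t}"
  shows "lsw_characteristic L (\<xi> s) s \<xi>"
  using assms unfolding lsw_characteristic_def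
  by (auto intro: has_field_derivative_subset[where s="{0..t}"])

lemma characteristic_end: "lsw_characteristic L x t \<xi> \<Longrightarrow> \<xi> t = x"
  by (simp add: lsw_characteristic_def)

lemma characteristic_nonneg: "lsw_characteristic L x t \<xi> \<Longrightarrow> s \<in> {0..t} \<Longrightarrow> 0 \<le> \<xi> s"
  by (simp add: lsw_characteristic_def)

lemma characteristic_deriv:
  "lsw_characteristic L x t \<xi> \<Longrightarrow> s \<in> {0..t} \<Longrightarrow>
    (\<xi> has_real_derivative - (1 - root 3 (\<xi> s / L s))) (at s within {0..t})"
  by (simp add: lsw_characteristic_def)

lemma characteristic_continuous: "lsw_characteristic L x t \<xi> \<Longrightarrow> continuous_on {0..t} \<xi>"
  by (rule DERIV_continuous_on) (rule characteristic_deriv)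

locale lsw_flow =
  fixes L :: "real \<Rightarrow> real"
  assumes L_pos: "\<And>t. t \<ge> 0 \<Longrightarrow> L t > 0"
begin

abbreviation "chr \<equiv> lsw_characteristic L"

text \<open>The velocity is nondecreasing in the position, so the difference \<open>D\<close> has
  the same sign as its derivative and its square is nondecreasing in time. A negative
  \<open>D s\<close> would have to pass through 0 before reaching \<open>D t\<close>, which a
  nondecreasing square forbids. The argument also covers 0, where the velocity is not
  Lipschitz.\<close>

lemma chr_gap:
  assumes \<xi>: "chr x t \<xi>" and \<eta>: "chr y t \<eta>" and xy: "x \<le> y" and s: "s \<in> {0..t}"
  shows "\<xi> s \<le> \<eta> s" "\<eta> s - \<xi> s \<le> y - x"
proof -
  define D where "D = (\<lambda>s. \<eta> s - \<xi> s)"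
  define D' where "D' = (\<lambda>s. root 3 (\<eta> s / L s) - root 3 (\<xi> s / L s))"
  have D: "(D has_real_derivative D' s) (at s within {0..t})" if "s \<in> {0..t}" for s
    unfolding D_def D'_def
    by (auto intro!: derivative_eq_intros characteristic_deriv[OF \<xi> that] characteristic_deriv[OF \<eta> that])
  have sq: "(D s1)\<^sup>2 \<le> (D s2)\<^sup>2" if "0 \<le> s1" "s1 \<le> s2" "s2 \<le> t" for s1 s2
  proof (rule nondecreasing_if_deriv_nonneg[where S="{0..t}" and f="\<lambda>s. (D s)\<^sup>2" and f'="\<lambda>s. 2 * (D s * D' s)"])
    fix s assume "s \<in> {s1..s2}"
    then have "s \<in> {0..t}" using that by auto
    then show "((\<lambda>s. (D s)\<^sup>2) has_real_derivative 2 * (D s * D' s)) (at s within {0..t})"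
      by (auto intro!: derivative_eq_intros D)
  next
    fix s assume "s1 < s" "s < s2"
    then have "L s > 0" using that L_pos by auto
    then have le: "\<eta> s / L s \<le> \<xi> s / L s \<longleftrightarrow> \<eta> s \<le> \<xi> s"
      "\<xi> s / L s \<le> \<eta> s / L s \<longleftrightarrow> \<xi> s \<le> \<eta> s"
      by (simp_all add: divide_le_cancel)
    have "D s \<ge> 0 \<longleftrightarrow> D' s \<ge> 0" "D s \<le> 0 \<longleftrightarrow> D' s \<le> 0"
      unfolding D_def D'_def diff_ge_0_iff_ge diff_le_0_iff_le
      by (simp_all only: real_root_le_iff[OF zero_less_numeral] le)
    then have "D s * D' s \<ge> 0" unfolding zero_le_mult_iff by (meson linear)
    then show "2 * (D s * D' s) \<ge> 0" by (simp only: mult_nonneg_nonneg zero_le_numeral)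
  qed (use that in auto)
  have Dt: "D t = y - x" using characteristic_end[OF \<xi>] characteristic_end[OF \<eta>] by (simp add: D_def)
  have "D s \<ge> 0"
  proof (rule ccontr)
    assume neg: "\<not> D s \<ge> 0"
    have "continuous_on {s..t} D"
      unfolding D_def using s
      by (auto intro!: continuous_intros continuous_on_subset[OF characteristic_continuous[OF \<xi>]]
          continuous_on_subset[OF characteristic_continuous[OF \<eta>]])
    then obtain s1 where "s \<le> s1" "s1 \<le> t" "D s1 = 0"
      using IVT'[of D s 0 t] neg Dt xy s by (metis atLeastAtMost_iff diff_ge_0_iff_ge linear)
    then show False using sq[of s s1] s neg by simp
  qed
  then show "\<xi> s \<le> \<eta> s" by (simp add: D_def)
  have "(D s)\<^sup>2 \<le> (y - x)\<^sup>2" using sq[of s t] s Dt by simp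
  then show "\<eta> s - \<xi> s \<le> y - x"
    using power2_le_imp_le[of "D s" "y - x"] xy by (simp add: D_def)
qed

lemma chr_gap_mono:
  assumes "chr x t \<xi>" "chr y t \<eta>" "x \<le> y" "0 \<le> s1" "s1 \<le> s2" "s2 \<le> t"
  shows "\<eta> s1 - \<xi> s1 \<le> \<eta> s2 - \<xi> s2"
  using chr_gap(2)[OF characteristic_restrict[OF assms(1), of s2] characteristic_restrict[OF assms(2), of s2], of s1]
    chr_gap(1)[OF assms(1-3), of s2] assms by auto

lemma chr_unique:
  assumes "chr x t \<xi>" "chr x t \<eta>" "s \<in> {0..t}"
  shows "\<xi> s = \<eta> s"
  using chr_gap(1)[OF assms(1,2) order_refl assms(3)] chr_gap(1)[OF assms(2,1) order_refl assms(3)] by simp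

text \<open>The velocity is at least -1 because its cube root term is nonnegative.\<close>

lemma chr_slope:
  assumes "chr x t \<xi>" "0 \<le> s1" "s1 \<le> s2" "s2 \<le> t"
  shows "\<xi> s1 - s2 + s1 \<le> \<xi> s2"
proof -
  have "\<xi> s1 + s1 \<le> \<xi> s2 + s2"
  proof (rule nondecreasing_if_deriv_nonneg[where S="{0..t}" and f="\<lambda>s. \<xi> s + s" and f'="\<lambda>s. root 3 (\<xi> s / L s)"])
    fix s assume "s \<in> {s1..s2}"
    then show "((\<lambda>s. \<xi> s + s) has_real_derivative root 3 (\<xi> s / L s)) (at s within {0..t})"
      using assms by (auto intro!: derivative_eq_intros characteristic_deriv[OF assms(1)])
  next
    fix s assume "s1 < s" "s < s2"
    then have "0 \<le> \<xi> s / L s" using L_pos[of s] characteristic_nonneg[OF assms(1), of s] assms by auto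
    then show "root 3 (\<xi> s / L s) \<ge> 0" by simp
  qed (use assms in auto)
  then show ?thesis by simp
qed

text \<open>At 0 the velocity is -1, so a characteristic touching 0 before its final time would
  become negative.\<close>

lemma chr_pos:
  assumes \<xi>: "chr x t \<xi>" and s: "0 \<le> s" "s < t"
  shows "\<xi> s > 0"
proof (rule ccontr)
  assume "\<not> \<xi> s > 0"
  then have 0: "\<xi> s = 0" using characteristic_nonneg[OF \<xi>, of s] s by auto
  have "(\<xi> has_real_derivative -1) (at s within {0..t})"
    using characteristic_deriv[OF \<xi>, of s] 0 s by simp
  from has_real_derivative_neg_dec_right[OF this]
  obtain d where d: "d > 0" "\<And>h. 0 < h \<Longrightarrow> s + h \<in> {0..t} \<Longrightarrow> h < d \<Longrightarrow> \<xi> s > \<xi> (s + h)" by auto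
  define h where "h = min (d/2) (t - s)"
  have "0 < h" "h < d" "s + h \<in> {0..t}" using d(1) s by (auto simp: h_def)
  then show False using d(2)[of h] 0 characteristic_nonneg[OF \<xi>, of "s+h"] by auto
qed

lemma chr_pos':
  assumes \<xi>: "chr x t \<xi>" and s: "0 \<le> s" "s \<le> t" and "x > 0"
  shows "\<xi> s > 0"
  using chr_pos[OF \<xi>, of s] characteristic_end[OF \<xi>] assms by (cases "s = t") auto

lemma gap_deriv:
  assumes \<xi>: "chr x t \<xi>" and \<eta>: "chr y t \<eta>" and s: "s \<in> {0..t}" and less: "\<xi> s < \<eta> s"
  shows "((\<lambda>s. \<eta> s - \<xi> s) has_real_derivative kern (\<xi> s) (\<eta> s) / root 3 (L s) * (\<eta> s - \<xi> s))
            (at s within {0..t})"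
proof -
  have "((\<lambda>s. \<eta> s - \<xi> s) has_real_derivative root 3 (\<eta> s / L s) - root 3 (\<xi> s / L s)) (at s within {0..t})"
    by (auto intro!: derivative_eq_intros characteristic_deriv[OF \<xi> s] characteristic_deriv[OF \<eta> s])
  moreover have "root 3 (\<eta> s / L s) - root 3 (\<xi> s / L s) = kern (\<xi> s) (\<eta> s) / root 3 (L s) * (\<eta> s - \<xi> s)"
    using root3_diff[of "\<xi> s" "\<eta> s"] less characteristic_nonneg[OF \<xi> s]
    by (simp add: real_root_divide flip: diff_divide_distrib)
  ultimately show ?thesis by simp
qed

lemma ln_gap_deriv:
  assumes \<xi>: "chr x t \<xi>" and \<eta>: "chr y t \<eta>" and s: "s \<in> {0..t}" and less: "\<xi> s < \<eta> s"
  shows "((\<lambda>s. ln (\<eta> s - \<xi> s)) has_real_derivative kern (\<xi> s) (\<eta> s) / root 3 (L s)) (at s within {0..t})"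
  using DERIV_chain2[OF DERIV_ln_divide gap_deriv[OF assms]] less by auto

end

section \<open>Monotonicity and cross inequalities of the divided difference\<close>

lemma kern_pos: "0 \<le> x \<Longrightarrow> 0 < y \<Longrightarrow> 0 < kern x y"
  unfolding kern_def by (intro divide_pos_pos cube_denominator_pos) auto

lemma kern_antimono:
  assumes "0 \<le> x" "0 < y" "x \<le> x'" "y \<le> y'"
  shows "kern x' y' \<le> kern x y"
proof -
  have "(root 3 x)\<^sup>2 + root 3 x * root 3 y + (root 3 y)\<^sup>2
      \<le> (root 3 x')\<^sup>2 + root 3 x' * root 3 y' + (root 3 y')\<^sup>2"
    using assms by (intro add_mono power_mono mult_mono) auto
  then show ?thesis
    unfolding kern_def using cube_denominator_pos[of "root 3 x" "root 3 y"] assms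
    by (intro divide_left_mono mult_pos_pos) auto
qed

text \<open>This is the infinitesimal form of the cross ratio inequality, in terms of cube roots.
  After rearrangement both sides are differences of reciprocals with the common factor
  \<open>c - b\<close>, and the remaining factors can be compared one by one.\<close>

lemma kern_cross_aux:
  fixes a b c d :: real
  assumes "0 \<le> a" "a < b" "b < c" "c < d"
  shows "1 / (a\<^sup>2 + a*c + c\<^sup>2) + 1 / (b\<^sup>2 + b*d + d\<^sup>2) \<le> 1 / (a\<^sup>2 + a*b + b\<^sup>2) + 1 / (c\<^sup>2 + c*d + d\<^sup>2)"
proof -
  define K where "K = (\<lambda>x y::real. x\<^sup>2 + x*y + y\<^sup>2)"
  have K: "K a b > 0" "K a c > 0" "K b d > 0" "K c d > 0"
    using assms unfolding K_def by (auto intro!: cube_denominator_pos)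
  have "(a+b+c) * K b d - (b+c+d) * K a b = (d - a) * (a * d + b * (d + a) + c * (d + a + b))"
    unfolding K_def by algebra
  moreover have "\<dots> \<ge> 0" using assms by (intro mult_nonneg_nonneg add_nonneg_nonneg) auto
  ultimately have "(b+c+d) * K a b \<le> (a+b+c) * K b d" by linarith
  then have 1: "(b+c+d) / K b d \<le> (a+b+c) / K a b"
    using K by (simp add: divide_simps mult.commute)
  have "K a c \<le> K c d"
  proof -
    have "a\<^sup>2 \<le> d\<^sup>2" "a * c \<le> c * d" using assms by (auto intro: power_mono simp: mult.commute)
    then show ?thesis by (simp add: K_def)
  qed
  then have 2: "1 / K c d \<le> 1 / K a c" using K by (simp add: divide_simps)
  have "(b+c+d) / K b d * (1 / K c d) \<le> (a+b+c) / K a b * (1 / K a c)"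
    using K assms by (intro mult_mono 1 2) auto
  then have 3: "(c - b) * ((b+c+d) / (K b d * K c d)) \<le> (c - b) * ((a+b+c) / (K a b * K a c))"
    using assms by (intro mult_left_mono) auto
  have "1 / K a b - 1 / K a c = (K a c - K a b) / (K a b * K a c)"
    using K by (simp add: diff_divide_distrib)
  also have "K a c - K a b = (c - b) * (a + b + c)" unfolding K_def by algebra
  finally have 4: "1 / K a b - 1 / K a c = (c - b) * ((a+b+c) / (K a b * K a c))" by simp
  have "1 / K b d - 1 / K c d = (K c d - K b d) / (K b d * K c d)"
    using K by (simp add: diff_divide_distrib)
  also have "K c d - K b d = (c - b) * (b + c + d)" unfolding K_def by algebra
  finally have 5: "1 / K b d - 1 / K c d = (c - b) * ((b+c+d) / (K b d * K c d))" by simp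
  show ?thesis using 3 4 5 unfolding K_def by linarith
qed

lemma kern_cross:
  assumes "0 \<le> p" "p < q" "q < r" "r < s"
  shows "kern p r + kern q s \<le> kern p q + kern r s"
  unfolding kern_def using assms by (intro kern_cross_aux) auto

text \<open>Up to \<open>1 / root 3 (L s)\<close> the factor \<open>kern x z * (z - x)\<close> is
  the growth rate of the gap \<open>z - x\<close>. As long as the middle point stays away from 0,
  the distortion of adjacent gaps therefore integrates to a bound by the final gap, whatever the
  elapsed time.\<close>

lemma kern_diff_le:
  assumes "0 \<le> x" "x < y" "y < z"
  shows "kern x y - kern y z \<le> 3 / y * (kern x z * (z - x))"
proof -
  define b c d where "b = root 3 x" and "c = root 3 y" and "d = root 3 z"
  have o: "0 \<le> b" "b < c" "c < d" using assms by (auto simp: b_def c_def d_def)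
  define K where "K = (\<lambda>x y::real. x\<^sup>2 + x*y + y\<^sup>2)"
  have K: "K b c > 0" "K c d > 0"
    using o unfolding K_def by (auto intro!: cube_denominator_pos)
  have "1 / K b c - 1 / K c d = (K c d - K b c) / (K b c * K c d)"
    using K by (simp add: diff_divide_distrib)
  also have "K c d - K b c = (d - b) * (b + c + d)" unfolding K_def by algebra
  finally have "1 / K b c - 1 / K c d = (b + c + d) / (K b c * K c d) * (d - b)" by simp
  \<comment> \<open>The denominators are bounded below by the single terms \<open>c^2\<close> of
    \<open>K b c\<close> and \<open>c * d\<close> of \<open>K c d\<close>, so that \<open>d\<close>
    cancels.\<close>
  also have "\<dots> \<le> (3 * d) / (c\<^sup>2 * (c * d)) * (d - b)"
    using o K unfolding K_def
    by (intro mult_right_mono frac_le mult_mono) (auto intro!: mult_pos_pos add_nonneg_nonneg)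
  also have "\<dots> = 3 / c^3 * (d - b)" using o by (simp add: power2_eq_square power3_eq_cube)
  also have "c^3 = y" by (simp add: c_def root3_cube)
  also have "d - b = kern x z * (z - x)" using root3_diff[of x z] assms by (simp add: b_def d_def)
  finally show ?thesis by (simp add: kern_def K_def b_def c_def d_def)
qed

section \<open>Distortion of gaps by the flow\<close>

context lsw_flow
begin

lemma chr_less_forward:
  assumes "chr x t \<xi>" "chr y t \<eta>" "0 \<le> s0" "s0 \<le> s" "s \<le> t" "\<xi> s0 < \<eta> s0"
  shows "\<xi> s < \<eta> s"
proof (cases "x \<le> y")
  case True
  then show ?thesis using chr_gap_mono[OF assms(1,2) True assms(3,4,5)] assms(6) by simp
next
  case False
  then show ?thesis using chr_gap(1)[OF assms(2,1), of s0] assms by auto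
qed

text \<open>Characteristics that agree at \<open>s\<close> can separate later only where the
  velocity is not Lipschitz, that is at 0, and they are positive before their final time. Gronwall's
  inequality on an interval that stops short of \<open>t\<close> excludes this.\<close>

lemma chr_less_backward:
  assumes \<xi>: "chr x t \<xi>" and \<eta>: "chr y t \<eta>" and xy: "x < y" and s: "s \<in> {0..t}"
    and Lcont: "continuous_on {0..t} L"
  shows "\<xi> s < \<eta> s"
proof (rule ccontr)
  assume "\<not> \<xi> s < \<eta> s"
  then have eq: "\<eta> s = \<xi> s" using chr_gap(1)[OF \<xi> \<eta> _ s] xy by auto
  define D where "D = (\<lambda>s. \<eta> s - \<xi> s)"
  have D0: "D u \<ge> 0" if "u \<in> {0..t}" for u using chr_gap(1)[OF \<xi> \<eta> _ that] xy by (simp add: D_def)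
  have Dt: "D t > 0" using xy characteristic_end[OF \<xi>] characteristic_end[OF \<eta>] by (simp add: D_def)
  have "s < t" using eq Dt s by (cases "s = t") (auto simp: D_def)
  have "continuous_on {s..t} D"
    unfolding D_def using s
    by (auto intro!: continuous_intros continuous_on_subset[OF characteristic_continuous[OF \<xi>]]
        continuous_on_subset[OF characteristic_continuous[OF \<eta>]])
  moreover have "D s \<le> D t / 2" "D t / 2 \<le> D t" using Dt eq by (auto simp: D_def)
  \<comment> \<open>Stopping when half of the final gap is reached keeps \<open>[s,t1]\<close> away
    from \<open>t\<close>, where \<xi> may be 0.\<close>
  ultimately obtain t1 where t1: "s \<le> t1" "t1 \<le> t" "D t1 = D t / 2"
    using IVT'[of D s "D t / 2" t] \<open>s < t\<close> by auto
  have "t1 < t" "s < t1" using t1 Dt eq by (cases "t1 = t"; cases "t1 = s"; auto simp: D_def)+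
  \<comment> \<open>An upper bound for the difference quotients of the velocity above
    \<open>\<xi> u\<close>, obtained from \<open>kern\<close> by dropping two terms of the
    denominator. It is bounded because \<xi> is positive on the compact interval.\<close>
  define k where "k = (\<lambda>u. 1 / (root 3 (L u) * (root 3 (\<xi> u))\<^sup>2))"
  have Lp: "L u > 0" if "u \<in> {s..t1}" for u using L_pos that s by auto
  have \<xi>p: "\<xi> u > 0" if "u \<in> {s..t1}" for u using chr_pos[OF \<xi>, of u] that s \<open>t1 < t\<close> by auto
  have "continuous_on {s..t1} k"
    unfolding k_def using s t1 Lp \<xi>p
    by (intro continuous_intros continuous_on_subset[OF Lcont]
        continuous_on_subset[OF characteristic_continuous[OF \<xi>]])
       (fastforce simp: less_le)+
  then have "bdd_above (k ` {s..t1})"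
    by (intro compact_imp_bounded bounded_imp_bdd_above compact_continuous_image) auto
  then obtain C where C: "\<And>u. u \<in> {s..t1} \<Longrightarrow> k u \<le> C" unfolding bdd_above_def by blast
  define D' where "D' = (\<lambda>s. root 3 (\<eta> s / L s) - root 3 (\<xi> s / L s))"
  have D: "(D has_real_derivative D' u) (at u within {0..t})" if "u \<in> {0..t}" for u
    unfolding D_def D'_def
    by (auto intro!: derivative_eq_intros characteristic_deriv[OF \<xi> that] characteristic_deriv[OF \<eta> that])
  have D'le: "D' u \<le> C * D u" if u: "u \<in> {s..t1}" for u
  proof (cases "D u = 0")
    case True
    then show ?thesis by (simp add: D'_def D_def)
  next
    case False
    then have less: "\<xi> u < \<eta> u" using D0[of u] u s \<open>t1 < t\<close> by (auto simp: D_def)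
    have "D' u = kern (\<xi> u) (\<eta> u) / root 3 (L u) * D u"
      using root3_diff[OF _ less] \<xi>p[OF u]
      by (simp add: D'_def D_def real_root_divide flip: diff_divide_distrib)
    also have "\<dots> \<le> k u * D u"
    proof (rule mult_right_mono)
      have "kern (\<xi> u) (\<eta> u) \<le> 1 / (root 3 (\<xi> u))\<^sup>2"
        unfolding kern_def using \<xi>p[OF u] less
        by (intro divide_left_mono mult_pos_pos cube_denominator_pos) auto
      then show "kern (\<xi> u) (\<eta> u) / root 3 (L u) \<le> k u"
        using divide_right_mono[of "kern (\<xi> u) (\<eta> u)" "1 / (root 3 (\<xi> u))\<^sup>2" "root 3 (L u)"] Lp[OF u]
        by (simp add: k_def mult.commute)
    qed (use less in \<open>auto simp: D_def\<close>)
    also have "\<dots> \<le> C * D u" using C[OF u] less by (intro mult_right_mono) (auto simp: D_def)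
    finally show ?thesis .
  qed
  \<comment> \<open>Gronwall's inequality: \<open>D u * exp (- C * u)\<close> does not increase, yet
    it vanishes at \<open>s\<close> and is positive at \<open>t1\<close>.\<close>
  have "- (D s * exp (- C * s)) \<le> - (D t1 * exp (- C * t1))"
  proof (rule nondecreasing_if_deriv_nonneg[where S="{0..t}" and f="\<lambda>u. - (D u * exp (- C * u))"
        and f'="\<lambda>u. (C * D u - D' u) * exp (- C * u)"])
    fix u assume "u \<in> {s..t1}"
    then have "u \<in> {0..t}" using s t1 by auto
    then show "((\<lambda>u. - (D u * exp (- C * u))) has_real_derivative (C * D u - D' u) * exp (- C * u)) (at u within {0..t})"
      by (auto intro!: derivative_eq_intros D simp: algebra_simps)
  next
    fix u assume "s < u" "u < t1"
    then show "0 \<le> (C * D u - D' u) * exp (- C * u)"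
      using D'le[of u] by auto
  qed (use s t1 in auto)
  moreover have "D s = 0" using eq by (simp add: D_def)
  ultimately show False using t1 Dt by (simp add: mult_le_0_iff)
qed

text \<open>\<open>kern\<close> decreases in both arguments, so of two adjacent gaps the one closer
  to 0 has the larger logarithmic growth rate. This is concavity of the forward flow, stated without
  quotients.\<close>

lemma gap_ratio_mono:
  assumes c: "chr x0 t \<xi>0" "chr x1 t \<xi>1" "chr x2 t \<xi>2"
    and s: "0 \<le> s1" "s1 \<le> s2" "s2 \<le> t"
    and less: "\<xi>0 s1 < \<xi>1 s1" "\<xi>1 s1 < \<xi>2 s1"
  shows "(\<xi>1 s1 - \<xi>0 s1) * (\<xi>2 s2 - \<xi>1 s2) \<le> (\<xi>1 s2 - \<xi>0 s2) * (\<xi>2 s1 - \<xi>1 s1)"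
proof -
  have l: "\<xi>0 s < \<xi>1 s" "\<xi>1 s < \<xi>2 s" if "s \<in> {s1..s2}" for s
    using chr_less_forward[OF c(1,2) _ _ _ less(1)] chr_less_forward[OF c(2,3) _ _ _ less(2)] s that by auto
  have "ln (\<xi>1 s1 - \<xi>0 s1) - ln (\<xi>2 s1 - \<xi>1 s1) \<le> ln (\<xi>1 s2 - \<xi>0 s2) - ln (\<xi>2 s2 - \<xi>1 s2)"
  proof (rule nondecreasing_if_deriv_nonneg[where S="{0..t}"
        and f="\<lambda>s. ln (\<xi>1 s - \<xi>0 s) - ln (\<xi>2 s - \<xi>1 s)"
        and f'="\<lambda>s. kern (\<xi>0 s) (\<xi>1 s) / root 3 (L s) - kern (\<xi>1 s) (\<xi>2 s) / root 3 (L s)"])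
    fix u assume u: "u \<in> {s1..s2}"
    then have "u \<in> {0..t}" using s by auto
    then show "((\<lambda>s. ln (\<xi>1 s - \<xi>0 s) - ln (\<xi>2 s - \<xi>1 s)) has_real_derivative
        kern (\<xi>0 u) (\<xi>1 u) / root 3 (L u) - kern (\<xi>1 u) (\<xi>2 u) / root 3 (L u)) (at u within {0..t})"
      using u by (intro DERIV_diff ln_gap_deriv[OF c(1,2)] ln_gap_deriv[OF c(2,3)] l) auto
  next
    fix u assume "s1 < u" "u < s2"
    then have u: "u \<in> {s1..s2}" "u \<in> {0..t}" using s by auto
    have "kern (\<xi>1 u) (\<xi>2 u) \<le> kern (\<xi>0 u) (\<xi>1 u)"
      using l[OF u(1)] characteristic_nonneg[OF c(1) u(2)] by (intro kern_antimono) auto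
    then show "0 \<le> kern (\<xi>0 u) (\<xi>1 u) / root 3 (L u) - kern (\<xi>1 u) (\<xi>2 u) / root 3 (L u)"
      using L_pos[of u] u by (simp add: divide_right_mono)
  qed (use s in auto)
  then have "ln ((\<xi>1 s1 - \<xi>0 s1) * (\<xi>2 s2 - \<xi>1 s2)) \<le> ln ((\<xi>1 s2 - \<xi>0 s2) * (\<xi>2 s1 - \<xi>1 s1))"
    using l[of s1] l[of s2] s by (simp add: ln_mult)
  then show ?thesis using l[of s1] l[of s2] s by simp
qed

text \<open>The velocity has a nonnegative third derivative in \<open>x\<close>, so the forward flow has nonnegative
  Schwarzian derivative and increases cross ratios; this is the Koebe principle.\<close>

lemma cross_ratio_mono:
  assumes c: "chr x0 t \<pi>" "chr x1 t \<phi>" "chr x2 t \<rho>" "chr x3 t \<sigma>"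
    and less: "\<pi> 0 < \<phi> 0" "\<phi> 0 < \<rho> 0" "\<rho> 0 < \<sigma> 0" and t: "0 \<le> t"
  shows "(\<phi> 0 - \<pi> 0) * (\<sigma> 0 - \<rho> 0) / ((\<rho> 0 - \<pi> 0) * (\<sigma> 0 - \<phi> 0))
    \<le> (x1 - x0) * (x3 - x2) / ((x2 - x0) * (x3 - x1))"
proof -
  have l: "\<pi> s < \<phi> s" "\<phi> s < \<rho> s" "\<rho> s < \<sigma> s" "\<pi> s < \<rho> s" "\<phi> s < \<sigma> s" if "s \<in> {0..t}" for s
    using chr_less_forward[OF c(1,2) _ _ _ less(1), of s] chr_less_forward[OF c(2,3) _ _ _ less(2), of s]
      chr_less_forward[OF c(3,4) _ _ _ less(3), of s] that by auto
  let ?f = "\<lambda>s. ln (\<phi> s - \<pi> s) + ln (\<sigma> s - \<rho> s) - ln (\<rho> s - \<pi> s) - ln (\<sigma> s - \<phi> s)"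
  let ?k = "\<lambda>s. kern (\<pi> s) (\<phi> s) / root 3 (L s) + kern (\<rho> s) (\<sigma> s) / root 3 (L s)
            - kern (\<pi> s) (\<rho> s) / root 3 (L s) - kern (\<phi> s) (\<sigma> s) / root 3 (L s)"
  have "?f 0 \<le> ?f t"
  proof (rule nondecreasing_if_deriv_nonneg[where S="{0..t}" and f="?f" and f'="?k"])
    fix u assume u: "u \<in> {0..t}"
    then show "(?f has_real_derivative ?k u) (at u within {0..t})"
      by (intro DERIV_diff DERIV_add ln_gap_deriv[OF c(1,2)] ln_gap_deriv[OF c(3,4)]
          ln_gap_deriv[OF c(1,3)] ln_gap_deriv[OF c(2,4)] l)
  next
    fix u assume "0 < u" "u < t"
    then have u: "u \<in> {0..t}" by auto
    have "kern (\<pi> u) (\<rho> u) + kern (\<phi> u) (\<sigma> u) \<le> kern (\<pi> u) (\<phi> u) + kern (\<rho> u) (\<sigma> u)"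
      using l[OF u] characteristic_nonneg[OF c(1) u] by (intro kern_cross) auto
    then have "0 \<le> (kern (\<pi> u) (\<phi> u) + kern (\<rho> u) (\<sigma> u) - kern (\<pi> u) (\<rho> u) - kern (\<phi> u) (\<sigma> u)) / root 3 (L u)"
      using L_pos[of u] u by (intro divide_nonneg_nonneg) auto
    then show "0 \<le> ?k u" by (simp add: add_divide_distrib diff_divide_distrib)
  qed (use t in auto)
  then have "ln ((\<phi> 0 - \<pi> 0) * (\<sigma> 0 - \<rho> 0) / ((\<rho> 0 - \<pi> 0) * (\<sigma> 0 - \<phi> 0)))
    \<le> ln ((\<phi> t - \<pi> t) * (\<sigma> t - \<rho> t) / ((\<rho> t - \<pi> t) * (\<sigma> t - \<phi> t)))"
    using l[of 0] l[of t] t by (simp add: ln_mult ln_div)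
  then have "(\<phi> 0 - \<pi> 0) * (\<sigma> 0 - \<rho> 0) / ((\<rho> 0 - \<pi> 0) * (\<sigma> 0 - \<phi> 0))
    \<le> (\<phi> t - \<pi> t) * (\<sigma> t - \<rho> t) / ((\<rho> t - \<pi> t) * (\<sigma> t - \<phi> t))"
    using l[of 0] l[of t] t by (subst (asm) ln_le_cancel_iff) auto
  then show ?thesis using c[THEN characteristic_end] by simp
qed

text \<open>Here no point below \<phi> provides Koebe space. Instead \<open>kern_diff_le\<close>
  bounds the logarithmic decrease of the ratio by \<open>3 / \<epsilon>\<close> times the growth of
  the gap \<open>\<sigma> - \<phi>\<close>, which amounts to at most
  \<open>\<sigma> s2\<close>.\<close>

lemma ratio_after_first_absorption:
  assumes c: "chr x1 t \<phi>" "chr x2 t \<rho>" "chr x3 t \<sigma>"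
    and s: "0 \<le> s1" "s1 \<le> s2" "s2 \<le> t"
    and less: "\<phi> s1 < \<rho> s1" "\<rho> s1 < \<sigma> s1"
    and \<epsilon>: "\<epsilon> > 0" "\<And>s. s \<in> {s1..s2} \<Longrightarrow> \<epsilon> \<le> \<rho> s"
  shows "(\<sigma> s1 - \<rho> s1) / (\<rho> s1 - \<phi> s1) * exp (- 3 * \<sigma> s2 / \<epsilon>) \<le> (\<sigma> s2 - \<rho> s2) / (\<rho> s2 - \<phi> s2)"
proof -
  have l: "\<phi> s < \<rho> s" "\<rho> s < \<sigma> s" "\<phi> s < \<sigma> s" if "s \<in> {s1..s2}" for s
    using chr_less_forward[OF c(1,2) _ _ _ less(1), of s] chr_less_forward[OF c(2,3) _ _ _ less(2), of s]
      s that by auto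
  \<comment> \<open>The last term compensates the possible decrease of the logarithmic
    ratio.\<close>
  let ?f = "\<lambda>s. ln (\<sigma> s - \<rho> s) - ln (\<rho> s - \<phi> s) + 3 / \<epsilon> * (\<sigma> s - \<phi> s)"
  let ?k = "\<lambda>s. kern (\<rho> s) (\<sigma> s) / root 3 (L s) - kern (\<phi> s) (\<rho> s) / root 3 (L s)
      + 3 / \<epsilon> * (kern (\<phi> s) (\<sigma> s) / root 3 (L s) * (\<sigma> s - \<phi> s))"
  have "?f s1 \<le> ?f s2"
  proof (rule nondecreasing_if_deriv_nonneg[where S="{0..t}" and f="?f" and f'="?k"])
    fix u assume u: "u \<in> {s1..s2}"
    then have u': "u \<in> {0..t}" using s by auto
    show "(?f has_real_derivative ?k u) (at u within {0..t})"
      using u u' by (intro DERIV_diff DERIV_add DERIV_cmult ln_gap_deriv[OF c(1,2)] ln_gap_deriv[OF c(2,3)]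
          gap_deriv[OF c(1,3)] l)
  next
    fix u assume "s1 < u" "u < s2"
    then have u: "u \<in> {s1..s2}" and u': "u \<in> {0..t}" using s by auto
    have \<phi>0: "0 \<le> \<phi> u" using characteristic_nonneg[OF c(1) u'] .
    have "kern (\<phi> u) (\<rho> u) - kern (\<rho> u) (\<sigma> u) \<le> 3 / \<rho> u * (kern (\<phi> u) (\<sigma> u) * (\<sigma> u - \<phi> u))"
      using l[OF u] \<phi>0 by (intro kern_diff_le) auto
    also have "\<dots> \<le> 3 / \<epsilon> * (kern (\<phi> u) (\<sigma> u) * (\<sigma> u - \<phi> u))"
    proof (rule mult_right_mono)
      show "3 / \<rho> u \<le> 3 / \<epsilon>" using \<epsilon>(1) \<epsilon>(2)[OF u] by (intro divide_left_mono) auto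
      show "0 \<le> kern (\<phi> u) (\<sigma> u) * (\<sigma> u - \<phi> u)"
        using kern_pos[of "\<phi> u" "\<sigma> u"] l[OF u] \<phi>0 by auto
    qed
    finally have "0 \<le> (kern (\<rho> u) (\<sigma> u) - kern (\<phi> u) (\<rho> u)
        + 3 / \<epsilon> * (kern (\<phi> u) (\<sigma> u) * (\<sigma> u - \<phi> u))) / root 3 (L u)"
      using L_pos[of u] u' by (intro divide_nonneg_nonneg) auto
    then show "0 \<le> ?k u" by (simp add: add_divide_distrib diff_divide_distrib)
  qed (use s in auto)
  moreover have "3 / \<epsilon> * (\<sigma> s1 - \<phi> s1) \<ge> 0" using l[of s1] s \<epsilon>(1) by auto
  moreover have "3 / \<epsilon> * (\<sigma> s2 - \<phi> s2) \<le> 3 / \<epsilon> * \<sigma> s2"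
    using characteristic_nonneg[OF c(1), of s2] s \<epsilon>(1) by (intro mult_left_mono) auto
  ultimately have "ln (\<sigma> s1 - \<rho> s1) - ln (\<rho> s1 - \<phi> s1) + (- 3 * \<sigma> s2 / \<epsilon>)
      \<le> ln (\<sigma> s2 - \<rho> s2) - ln (\<rho> s2 - \<phi> s2)" by simp
  then have "exp (ln (\<sigma> s1 - \<rho> s1) - ln (\<rho> s1 - \<phi> s1) + (- 3 * \<sigma> s2 / \<epsilon>))
      \<le> exp (ln (\<sigma> s2 - \<rho> s2) - ln (\<rho> s2 - \<phi> s2))" by simp
  then show ?thesis unfolding exp_add exp_diff using l[of s1] l[of s2] s by simp
qed

text \<open>Below \<Lambda> the divided difference is at least its value on the diagonal at
  \<Lambda>, so gaps grow exponentially at a rate of at least \<open>1 / (6 * \<Lambda>)\<close>.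
  The gap itself cannot exceed \<Lambda>, which limits the time during which both particles are
  alive.\<close>

lemma gap_growth:
  assumes c: "chr x t \<rho>" "chr y t \<sigma>" and s: "0 \<le> s1" "s1 \<le> s2" "s2 \<le> t"
    and less: "\<rho> s1 < \<sigma> s1"
    and \<Lambda>: "\<Lambda> > 0" "\<And>s. s \<in> {s1..s2} \<Longrightarrow> \<sigma> s \<le> \<Lambda>" "\<And>s. s \<in> {s1..s2} \<Longrightarrow> L s \<le> 3 * \<Lambda>"
  shows "(\<sigma> s1 - \<rho> s1) * exp ((s2 - s1) / (6 * \<Lambda>)) \<le> \<Lambda>"
proof -
  have l: "\<rho> s < \<sigma> s" if "s \<in> {s1..s2}" for s
    using chr_less_forward[OF c _ _ _ less, of s] s that by auto
  have "ln (\<sigma> s1 - \<rho> s1) - s1 / (6 * \<Lambda>) \<le> ln (\<sigma> s2 - \<rho> s2) - s2 / (6 * \<Lambda>)"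
  proof (rule nondecreasing_if_deriv_nonneg[where S="{0..t}"
        and f="\<lambda>s. ln (\<sigma> s - \<rho> s) - s / (6 * \<Lambda>)"
        and f'="\<lambda>s. kern (\<rho> s) (\<sigma> s) / root 3 (L s) - 1 / (6 * \<Lambda>)"])
    fix u assume u: "u \<in> {s1..s2}"
    then have u': "u \<in> {0..t}" using s by auto
    have "((\<lambda>s. s / (6 * \<Lambda>)) has_real_derivative 1 / (6 * \<Lambda>)) (at u within {0..t})"
      by (intro DERIV_cdivide DERIV_ident)
    then show "((\<lambda>s. ln (\<sigma> s - \<rho> s) - s / (6 * \<Lambda>)) has_real_derivative
        kern (\<rho> u) (\<sigma> u) / root 3 (L u) - 1 / (6 * \<Lambda>)) (at u within {0..t})"
      using u' l[OF u] by (intro DERIV_diff ln_gap_deriv[OF c]) auto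
  next
    fix u assume "s1 < u" "u < s2"
    then have u: "u \<in> {s1..s2}" and u': "u \<in> {0..t}" using s by auto
    have \<rho>0: "0 \<le> \<rho> u" using characteristic_nonneg[OF c(1) u'] .
    have Lp: "L u > 0" using L_pos[of u] u' by auto
    \<comment> \<open>The factor 3 is enlarged to the cube 8, whose root is 2. Together with the 3
      from \<open>kern\<close> on the diagonal this gives the 6 in the rate.\<close>
    have le: "root 3 (L u) \<le> 2 * root 3 \<Lambda>"
    proof -
      have "root 3 (L u) \<le> root 3 (2 ^ 3 * \<Lambda>)" using \<Lambda>(3)[OF u] \<Lambda>(1) by simp
      also have "\<dots> = root 3 (2 ^ 3) * root 3 \<Lambda>" by (rule real_root_mult)
      also have "root 3 (2 ^ 3) = (2::real)" by (rule real_root_power_cancel) auto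
      finally show ?thesis .
    qed
    have "1 / (6 * \<Lambda>) = 1 / (3 * (root 3 \<Lambda>)\<^sup>2) / (2 * root 3 \<Lambda>)"
      using root3_cube[of \<Lambda>] by (simp add: power2_eq_square power3_eq_cube mult_ac)
    also have "\<dots> = kern \<Lambda> \<Lambda> / (2 * root 3 \<Lambda>)"
      by (simp add: kern_def power2_eq_square)
    also have "\<dots> \<le> kern (\<rho> u) (\<sigma> u) / root 3 (L u)"
    proof (rule frac_le)
      show "kern \<Lambda> \<Lambda> \<le> kern (\<rho> u) (\<sigma> u)"
        using \<Lambda>(2)[OF u] l[OF u] \<rho>0 by (intro kern_antimono) auto
      show "0 \<le> kern (\<rho> u) (\<sigma> u)" using kern_pos[of "\<rho> u" "\<sigma> u"] l[OF u] \<rho>0 by simp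
    qed (use Lp le in auto)
    finally show "0 \<le> kern (\<rho> u) (\<sigma> u) / root 3 (L u) - 1 / (6 * \<Lambda>)" by simp
  qed (use s in auto)
  then have "ln (\<sigma> s1 - \<rho> s1) + (s2 - s1) / (6 * \<Lambda>) \<le> ln (\<sigma> s2 - \<rho> s2)"
    by (simp add: diff_divide_distrib)
  then have "exp (ln (\<sigma> s1 - \<rho> s1) + (s2 - s1) / (6 * \<Lambda>)) \<le> exp (ln (\<sigma> s2 - \<rho> s2))" by simp
  then have "(\<sigma> s1 - \<rho> s1) * exp ((s2 - s1) / (6 * \<Lambda>)) \<le> \<sigma> s2 - \<rho> s2"
    unfolding exp_add using l[of s1] l[of s2] s by simp
  also have "\<dots> \<le> \<Lambda>"
    using characteristic_nonneg[OF c(1), of s2] \<Lambda>(2)[of s2] s by auto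
  finally show ?thesis .
qed

end

section \<open>The backward flow of a solution\<close>

lemma has_integral_nonneg_lborel:
  fixes f :: "real \<Rightarrow> real"
  assumes I: "(f has_integral r) S" and nonneg: "\<And>x. x \<in> S \<Longrightarrow> 0 \<le> f x"
    and meas: "(\<lambda>x. indicator S x * f x) \<in> borel_measurable borel"
  shows "set_integrable lborel S f" "(LBINT x:S. f x) = r"
proof -
  have "has_bochner_integral lborel (\<lambda>x. indicator S x * f x) r"
  proof (rule has_bochner_integral_nn_integral)
    show "(\<integral>\<^sup>+ x. ennreal (indicator S x * f x) \<partial>lborel) = ennreal r"
      by (rule nn_integral_has_integral_lebesgue[OF nonneg I])
    show "AE x in lborel. 0 \<le> indicator S x * f x" using nonneg by (auto simp: indicator_def)
    show "0 \<le> r" using has_integral_nonneg[OF I nonneg] .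
  qed (use meas in simp)
  then show "set_integrable lborel S f" "(LBINT x:S. f x) = r"
    by (auto simp: set_integrable_def set_lebesgue_integral_def has_bochner_integral_iff)
qed

lemma powr_set_integral:
  fixes \<alpha> c :: real
  assumes "\<alpha> > -1" "c \<ge> 0"
  shows "set_integrable lborel {0<..c} (\<lambda>x. x powr \<alpha>)"
    "(LBINT x:{0<..c}. x powr \<alpha>) = c powr (\<alpha> + 1) / (\<alpha> + 1)"
proof -
  have "((\<lambda>x. x powr \<alpha>) has_integral c powr (\<alpha> + 1) / (\<alpha> + 1)) {0<..c}"
  proof (rule has_integral_spike_set_eq[THEN iffD1, OF _ _ has_integral_powr_from_0[OF assms]])
    have "{0..c} - {0<..c} \<subseteq> {0}" by auto
    then show "negligible {x \<in> {0..c} - {0<..c}. x powr \<alpha> \<noteq> 0}"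
      by (intro negligible_subset[OF negligible_sing[of 0]]) auto
    have "{x \<in> {0<..c} - {0..c}. x powr \<alpha> \<noteq> 0} = {}" by auto
    then show "negligible {x \<in> {0<..c} - {0..c}. x powr \<alpha> \<noteq> 0}" by (simp only: negligible_empty)
  qed
  from has_integral_nonneg_lborel[OF this]
  show "set_integrable lborel {0<..c} (\<lambda>x. x powr \<alpha>)"
    "(LBINT x:{0<..c}. x powr \<alpha>) = c powr (\<alpha> + 1) / (\<alpha> + 1)" by simp_all
qed

lemma integrable_indicator_Icc: "integrable lborel (indicator {a..b::real} :: real \<Rightarrow> real)"
  by (rule integrable_real_indicator) (auto simp: emeasure_lborel_Icc_eq)

lemma set_integral_ge_rectangle:
  fixes f :: "real \<Rightarrow> real"
  assumes "set_integrable lborel {a..} f" "\<And>x. x \<ge> a \<Longrightarrow> f x \<ge> 0" "a \<le> y"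
    and c: "\<And>x. a \<le> x \<Longrightarrow> x \<le> y \<Longrightarrow> f x \<ge> c"
  shows "(y - a) * c \<le> (LBINT x:{a..}. f x)"
proof -
  have "(LBINT x:{a..y}. c) = (y - a) * c"
    using assms(3) by (simp add: set_lebesgue_integral_def mult.commute)
  moreover have "(LBINT x:{a..y}. c) \<le> (LBINT x:{a..}. f x)"
    unfolding set_lebesgue_integral_def
  proof (rule integral_mono)
    show "integrable lborel (\<lambda>x. indicator {a..y} x *\<^sub>R c)"
      using integrable_indicator_Icc by simp
    show "integrable lborel (\<lambda>x. indicator {a..} x *\<^sub>R f x)"
      using assms(1) by (simp add: set_integrable_def)
  qed (use assms(2) c in \<open>auto simp: indicator_def\<close>)
  ultimately show ?thesis by simp
qed

locale lsw_sol =
  fixes w0 :: "real \<Rightarrow> real" and w :: "real \<Rightarrow> real \<Rightarrow> real" and L :: "real \<Rightarrow> real"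
  assumes init: "lsw_initial_data w0" and sol: "lsw_solution w0 w L"

sublocale lsw_sol \<subseteq> lsw_flow L
  using sol by unfold_locales (simp add: lsw_solution_def)

lemma tail_int_antimono_bounds:
  assumes "lsw_initial_data w0" "0 \<le> x" "x \<le> y"
  shows "tail_int w0 y \<le> tail_int w0 x" "0 \<le> tail_int w0 x"
    "tail_int w0 x - tail_int w0 y \<le> (y - x) * w0 x" "(y - x) * w0 y \<le> tail_int w0 x - tail_int w0 y"
proof -
  have anti: "w0 v \<le> w0 u" if "0 \<le> u" "u \<le> v" for u v
    using assms(1) that unfolding lsw_initial_data_def monotone_on_def by auto
  have nn: "w0 u \<ge> 0" if "u \<ge> 0" for u
    using assms(1) that unfolding lsw_initial_data_def by auto
  have int: "set_integrable lborel A w0" if "A \<subseteq> {0..}" "A \<in> sets borel" for A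
    using assms(1) that set_integrable_subset[of lborel "{0..}" w0 A] unfolding lsw_initial_data_def by auto
  have "{x..} = {x..<y} \<union> {y..}" using assms by auto
  then have "tail_int w0 x = (LBINT u:{x..<y} \<union> {y..}. w0 u)" by (simp add: tail_int_def)
  also have "\<dots> = (LBINT u:{x..<y}. w0 u) + tail_int w0 y"
    unfolding tail_int_def using assms by (intro set_integral_Un int) auto
  finally have eq: "tail_int w0 x - tail_int w0 y = (LBINT u:{x..<y}. w0 u)" by simp
  have c: "(LBINT u:{x..<y}. c) = (y - x) * c" "set_integrable lborel {x..<y} (\<lambda>_. c)" for c :: real
    using assms by (simp_all add: set_lebesgue_integral_def set_integrable_def mult.commute)
  have "(LBINT u:{x..<y}. w0 u) \<le> (LBINT u:{x..<y}. w0 x)"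
    using assms anti by (intro set_integral_mono int c) auto
  then show "tail_int w0 x - tail_int w0 y \<le> (y - x) * w0 x" using eq c by simp
  have "(LBINT u:{x..<y}. w0 y) \<le> (LBINT u:{x..<y}. w0 u)"
    using assms anti by (intro set_integral_mono int c) auto
  then show 1: "(y - x) * w0 y \<le> tail_int w0 x - tail_int w0 y" using eq c by simp
  show "tail_int w0 y \<le> tail_int w0 x"
  proof -
    have "0 \<le> (y - x) * w0 y" using nn[of y] assms by (intro mult_nonneg_nonneg) auto
    then show ?thesis using 1 by linarith
  qed
  show "0 \<le> tail_int w0 x"
    unfolding tail_int_def set_lebesgue_integral_def using nn assms
    by (intro integral_nonneg_AE) (auto simp: indicator_def)
qed

context lsw_sol
begin

lemma L_cont: "continuous_on {0..} L"
  using sol by (simp add: lsw_solution_def)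

lemma w0_nonneg: "x \<ge> 0 \<Longrightarrow> w0 x \<ge> 0"
  using init unfolding lsw_initial_data_def by auto

lemma w0_antimono: "0 \<le> u \<Longrightarrow> u \<le> v \<Longrightarrow> w0 v \<le> w0 u"
  using init unfolding lsw_initial_data_def monotone_on_def by auto

lemma w0_integrable: "set_integrable lborel {0..} w0"
  using init unfolding lsw_initial_data_def by auto

text \<open>A chosen characteristic through \<open>(x,t)\<close>; only its values on
  \<open>{0..t}\<close> are determined, by \<open>chr_unique\<close>.\<close>

definition chi :: "real \<Rightarrow> real \<Rightarrow> real \<Rightarrow> real" where
  "chi x t = (SOME \<xi>. chr x t \<xi>)"

definition F :: "real \<Rightarrow> real \<Rightarrow> real" where
  "F x t = chi x t 0"

context
  fixes t :: real
  assumes t: "t \<ge> 0"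
begin

lemma ex_chr: "x \<ge> 0 \<Longrightarrow> \<exists>\<xi>. chr x t \<xi> \<and> w x t = w0 (\<xi> 0)"
  using sol t unfolding lsw_solution_def by blast

lemma chr_chi: "x \<ge> 0 \<Longrightarrow> chr x t (chi x t)"
  unfolding chi_def using ex_chr by (metis someI_ex)

lemma chr_0: "chr x t \<xi> \<Longrightarrow> \<xi> 0 = F x t"
  using chr_unique[OF _ chr_chi, of x \<xi> 0] t
  by (metis F_def atLeastAtMost_iff characteristic_end characteristic_nonneg order_refl)

lemma w_eq: "x \<ge> 0 \<Longrightarrow> w x t = w0 (F x t)"
  using ex_chr chr_0 by metis

lemma F_nonneg: "x \<ge> 0 \<Longrightarrow> F x t \<ge> 0"
  unfolding F_def using characteristic_nonneg[OF chr_chi] t by auto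

lemma F_mono: "0 \<le> x \<Longrightarrow> x \<le> y \<Longrightarrow> F x t \<le> F y t"
  unfolding F_def using chr_gap(1)[OF chr_chi chr_chi, of x y 0] t by auto

lemma F_lipschitz: "0 \<le> x \<Longrightarrow> x \<le> y \<Longrightarrow> F y t - F x t \<le> y - x"
  unfolding F_def using chr_gap(2)[OF chr_chi chr_chi, of x y 0] t by auto

lemma F_strict_mono: "0 \<le> x \<Longrightarrow> x < y \<Longrightarrow> F x t < F y t"
  unfolding F_def using chr_less_backward[OF chr_chi chr_chi, of x y 0] t
    continuous_on_subset[OF L_cont, of "{0..t}"] by auto

lemma F_restrict: "chr x t \<xi> \<Longrightarrow> s \<in> {0..t} \<Longrightarrow> F (\<xi> s) s = \<xi> 0"
  using chr_unique[OF characteristic_restrict[of L x t \<xi> s]]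
    someI[of "chr (\<xi> s) s" \<xi>, OF characteristic_restrict] t
  unfolding F_def chi_def by (metis atLeastAtMost_iff order_refl)

lemma F_continuous: "continuous_on {0..} (\<lambda>x. F x t)"
proof (rule continuous_onI)
  fix x e :: real assume "x \<in> {0..}" "e > 0"
  have "\<bar>F y t - F x t\<bar> \<le> \<bar>y - x\<bar>" if "y \<ge> 0" for y
    using F_mono[of x y] F_mono[of y x] F_lipschitz[of x y] F_lipschitz[of y x] \<open>x \<in> {0..}\<close> that
    by (cases "x \<le> y") auto
  then show "\<exists>d>0. \<forall>x'\<in>{0..}. dist x' x < d \<longrightarrow> dist (F x' t) (F x t) \<le> e"
    using \<open>e > 0\<close> by (intro exI[of _ e]) (fastforce simp: dist_real_def)
qed

text \<open>By \<open>gap_ratio_mono\<close> for the characteristics ending at 0, \<open>y\<close>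
  and \<open>x\<close>, the backward flow is convex in the space variable; beyond \<open>y\<close>
  it lies above the extended chord.\<close>

lemma F_chord:
  assumes "0 < y" "y \<le> x"
  shows "F 0 t + (F y t - F 0 t) / y * x \<le> F x t"
proof (cases "y = x")
  case True
  then show ?thesis using assms by simp
next
  case False
  have "(F y t - F 0 t) * (chi x t t - chi y t t) \<le> (chi y t t - chi 0 t t) * (F x t - F y t)"
    unfolding F_def using F_strict_mono[of 0 y] F_strict_mono[of y x] assms False t
    by (intro gap_ratio_mono[OF chr_chi chr_chi chr_chi]) (auto simp: F_def)
  then have "(F y t - F 0 t) * (x - y) \<le> y * (F x t - F y t)"
    using assms by (simp add: characteristic_end[OF chr_chi])
  then have "(F y t - F 0 t) * x \<le> y * (F x t - F 0 t)" by (simp add: algebra_simps)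
  then show ?thesis using assms by (simp add: field_simps)
qed

lemma w_nonneg: "x \<ge> 0 \<Longrightarrow> w x t \<ge> 0"
  using w_eq w0_nonneg F_nonneg by simp

lemma w_antimono: "0 \<le> x \<Longrightarrow> x \<le> y \<Longrightarrow> w y t \<le> w x t"
  using w_eq[of x] w_eq[of y] w0_antimono[OF F_nonneg F_mono] by simp

lemma w_integrable: "set_integrable lborel {0..} (\<lambda>x. w x t)"
  and w_integral: "(LBINT x:{0..}. w x t) = 1"
  using sol t unfolding lsw_solution_def by auto

text \<open>The region below a decreasing profile of mass 1 contains the rectangle of width
  \<open>y\<close> and height \<open>w y t\<close>.\<close>

lemma times_w_le: "y \<ge> 0 \<Longrightarrow> y * w y t \<le> 1"
  using set_integral_ge_rectangle[OF w_integrable w_nonneg, of y "w y t"] w_antimono w_integral by simp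

lemma w_0_pos: "w 0 t > 0"
proof (rule ccontr)
  assume "\<not> w 0 t > 0"
  then have "w x t = 0" if "x \<ge> 0" for x using w_antimono[of 0 x] w_nonneg[of x] that by auto
  then have "(LBINT x:{0..}. w x t) = 0"
    unfolding set_lebesgue_integral_def by (intro integral_eq_zero_AE) (auto simp: indicator_def)
  then show False using w_integral by simp
qed

text \<open>\<open>F 0 t\<close> is the initial position, or label, of the particle absorbed at 0 at
  time \<open>t\<close>; larger labels are still alive. The mass bound makes \<open>F\<close> exceed
  \<open>z\<close> far out, and the intermediate value theorem gives the current position.\<close>

lemma alive:
  assumes z: "F 0 t \<le> z" "w0 z > 0"
  obtains y where "0 \<le> y" "F y t = z" "y * w0 z \<le> 1"
proof -
  \<comment> \<open>Twice the largest position that the mass bound allows for the value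
    \<open>w0 z\<close>, so that \<open>w x t < w0 z\<close> is strict.\<close>
  define x where "x = 2 / w0 z"
  have x: "x > 0" using z by (simp add: x_def)
  have "w x t < w0 z" using times_w_le[of x] x z by (auto simp: x_def field_simps)
  then have "F x t > z"
    using w_eq[of x] w0_antimono[of "F x t" z] F_nonneg[of x] x by (auto simp: not_le[symmetric])
  moreover have "continuous_on {0..x} (\<lambda>x. F x t)"
    using continuous_on_subset[OF F_continuous] by auto
  ultimately obtain y where y: "0 \<le> y" "y \<le> x" "F y t = z"
    using IVT'[of "\<lambda>x. F x t" 0 z x] z x by auto
  then show ?thesis using that times_w_le[of y] w_eq[of y] by auto
qed

text \<open>The unit mass is split at \<open>y\<close>. Below \<open>y\<close> the profile is at
  most \<open>w 0 t\<close>; above it \<open>F_chord\<close> bounds it by \<open>w0\<close> along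
  the chord, and a linear substitution turns that part into the tail integral. The result bounds
  \<open>y\<close> from below.\<close>

lemma chord_mass:
  assumes y: "0 < y"
  shows "1 \<le> y * (w 0 t + tail_int w0 (F 0 t) / (F y t - F 0 t))"
proof -
  define f c where "f = F 0 t" and "c = (F y t - F 0 t) / y"
  have c: "c > 0" using F_strict_mono[of 0 y] y by (simp add: c_def)
  have f0: "f \<ge> 0" using F_nonneg by (simp add: f_def)
  have "integrable lborel (\<lambda>u. indicator {f..} u * w0 u)"
    using set_integrable_subset[OF w0_integrable, of "{f..}"] f0 by (auto simp: set_integrable_def)
  from lborel_integrable_real_affine[OF this, of c f] lborel_integral_real_affine[of c "\<lambda>u. indicator {f..} u * w0 u" f] c
  have I: "integrable lborel (\<lambda>x. indicator {f..} (f + c * x) * w0 (f + c * x))"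
     and E: "tail_int w0 f = c * (\<integral>x. indicator {f..} (f + c * x) * w0 (f + c * x) \<partial>lborel)"
    by (auto simp: tail_int_def set_lebesgue_integral_def)
  have eq: "(indicator {f..} (f + c * x) :: real) = indicator {0..} x" for x
    using c by (auto simp: indicator_def zero_le_mult_iff)
  have "1 = (\<integral>x. indicator {0..} x * w x t \<partial>lborel)"
    using w_integral by (simp add: set_lebesgue_integral_def)
  also have "\<dots> \<le> (\<integral>x. indicator {0..y} x * w 0 t + indicator {0..} x * w0 (f + c * x) \<partial>lborel)"
  proof (rule integral_mono)
    show "integrable lborel (\<lambda>x. indicator {0..} x * w x t)"
      using w_integrable by (simp add: set_integrable_def)
    show "integrable lborel (\<lambda>x. indicator {0..y} x * w 0 t + indicator {0..} x * w0 (f + c * x))"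
      using I integrable_indicator_Icc unfolding eq
      by (intro Bochner_Integration.integrable_add integrable_mult_left)
    fix x :: real
    consider "x < 0" | "0 \<le> x" "x \<le> y" | "y < x" by linarith
    then show "indicator {0..} x * w x t \<le> indicator {0..y} x * w 0 t + indicator {0..} x * w0 (f + c * x)"
    proof cases
      case 2
      then show ?thesis using w_antimono[of 0 x] w0_nonneg[of "f + c * x"] f0 c by simp
    next
      case 3
      then have "f + c * x \<le> F x t" using F_chord[OF y, of x] by (simp add: f_def c_def)
      then show ?thesis using 3 w_eq[of x] w0_antimono[of "f + c * x" "F x t"] f0 c y by simp
    qed simp
  qed
  also have "\<dots> = y * w 0 t + tail_int w0 f / c"
    using I E c y unfolding eq by (subst Bochner_Integration.integral_add) (auto simp: mult.commute)
  finally show ?thesis by (simp add: c_def f_def algebra_simps)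
qed

text \<open>The moment defining \<open>L\<close> is split at \<open>\<Lambda> = 1 / w 0 t\<close>:
  nearer to 0 the profile is at most \<open>w 0 t\<close>, and farther out the weight is at most
  \<open>\<Lambda> powr (-2/3)\<close> while the mass is at most 1.\<close>

lemma L_le: "L t \<le> 3 / w 0 t"
proof -
  define M where "M = w 0 t"
  have M: "M > 0" using w_0_pos by (simp add: M_def)
  define \<Lambda> where "\<Lambda> = 1 / M"
  have \<Lambda>: "\<Lambda> > 0" using M by (simp add: \<Lambda>_def)
  define r where "r = root 3 \<Lambda>"
  have r: "r > 0" "r ^ 3 = \<Lambda>" using \<Lambda> by (auto simp: r_def root3_cube)
  have Lt: "L t > 0" using L_pos t by auto
  have root: "root 3 (L t) = (1/3) * (LBINT x:{0<..}. x powr (-2/3) * w x t) / M"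
    using sol t unfolding lsw_solution_def M_def by auto
  \<comment> \<open>The integral of a non-integrable function is 0 by convention, which
    \<open>L t > 0\<close> excludes.\<close>
  have "(LBINT x:{0<..}. x powr (-2/3) * w x t) \<noteq> 0"
    using root Lt by (metis divide_eq_0_iff less_irrefl mult_zero_right real_root_gt_0_iff zero_less_numeral)
  then have i1: "integrable lborel (\<lambda>x. indicator {0<..} x * (x powr (-2/3) * w x t))"
    unfolding set_lebesgue_integral_def real_scaleR_def using not_integrable_integral_eq by blast
  note p = powr_set_integral[of "-2/3" \<Lambda>, simplified, unfolded set_integrable_def set_lebesgue_integral_def real_scaleR_def]
  have r1: "\<Lambda> powr (1/3) = r" using root_powr_inverse[of 3 \<Lambda>] \<Lambda> by (simp add: r_def)
  have "\<Lambda> powr (-2/3) = (\<Lambda> powr (1/3)) powr (-2)" by (simp add: powr_powr)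
  also have "\<dots> = 1 / r powr 2" unfolding r1 by (simp add: powr_minus_divide)
  also have "r powr 2 = r\<^sup>2" using r(1) by simp
  finally have r2: "\<Lambda> powr (-2/3) = 1 / r\<^sup>2" .
  have "(LBINT x:{0<..}. x powr (-2/3) * w x t) = (\<integral>x. indicator {0<..} x * (x powr (-2/3) * w x t) \<partial>lborel)"
    by (simp add: set_lebesgue_integral_def)
  also have "\<dots> \<le> (\<integral>x. M * (indicator {0<..\<Lambda>} x * x powr (-2/3)) + 1 / r\<^sup>2 * (indicator {0..} x * w x t) \<partial>lborel)"
  proof (rule integral_mono[OF i1])
    show "integrable lborel (\<lambda>x. M * (indicator {0<..\<Lambda>} x * x powr (-2/3)) + 1 / r\<^sup>2 * (indicator {0..} x * w x t))"
      using p \<Lambda> w_integrable by (intro Bochner_Integration.integrable_add integrable_mult_right) (auto simp: set_integrable_def)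
    fix x :: real
    consider "x \<le> 0" | "0 < x" "x \<le> \<Lambda>" | "\<Lambda> < x" by linarith
    then show "indicator {0<..} x * (x powr (-2/3) * w x t)
        \<le> M * (indicator {0<..\<Lambda>} x * x powr (-2/3)) + 1 / r\<^sup>2 * (indicator {0..} x * w x t)"
    proof cases
      case 1
      then show ?thesis using w_nonneg[of 0] \<Lambda> by (auto simp: indicator_def)
    next
      case 2
      then have "x powr (-2/3) * w x t \<le> x powr (-2/3) * M"
        unfolding M_def by (intro mult_left_mono w_antimono) auto
      then show ?thesis using 2 w_nonneg[of x] by (simp add: mult.commute add_increasing2)
    next
      case 3
      have "x powr (-2/3) \<le> \<Lambda> powr (-2/3)" using 3 \<Lambda> by (intro powr_mono2') auto
      then have "x powr (-2/3) * w x t \<le> 1 / r\<^sup>2 * w x t"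
        unfolding r2 using 3 \<Lambda> w_nonneg[of x] by (intro mult_right_mono) auto
      then show ?thesis using 3 \<Lambda> by simp
    qed
  qed
  also have "\<dots> = M * (3 * r) + 1 / r\<^sup>2"
    using p \<Lambda> w_integrable w_integral r1
    by (subst Bochner_Integration.integral_add) (auto simp: set_integrable_def set_lebesgue_integral_def)
  finally have "root 3 (L t) \<le> (1/3) * (M * (3 * r) + 1 / r\<^sup>2) / M"
    unfolding root using M by (intro divide_right_mono mult_left_mono) auto
  also have "\<dots> = r + 1 / (3 * r\<^sup>2) * \<Lambda>" using M by (simp add: \<Lambda>_def field_simps)
  also have "\<dots> = 4 / 3 * r"
    using r(1) by (simp add: r(2)[symmetric] field_simps power2_eq_square power3_eq_cube)
  finally have "root 3 (L t) ^ 3 \<le> (4 / 3 * r) ^ 3" using Lt by (intro power_mono) auto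
  also have "\<dots> = 64 / 27 * \<Lambda>" by (simp add: power_mult_distrib power_divide r(2))
  finally show ?thesis using M by (simp add: root3_cube \<Lambda>_def M_def divide_simps)
qed

end

section \<open>The label absorbed at 0 as a function of time\<close>

lemma F_0: "x \<ge> 0 \<Longrightarrow> F x 0 = x"
  using characteristic_end[OF chr_chi[of 0 x]] by (simp add: F_def)

text \<open>The particle absorbed at time \<open>t\<close> is at a position between 0 and
  \<open>t - s\<close> at time \<open>s\<close>, as its velocity is at least -1. Monotonicity and
  the Lipschitz bound of \<open>F\<close> at time \<open>s\<close> then apply.\<close>

lemma F0_mono:
  assumes "0 \<le> s" "s \<le> t"
  shows "F 0 s \<le> F 0 t" "F 0 t - F 0 s \<le> t - s"
proof -
  have t: "t \<ge> 0" and c: "chr 0 t (chi 0 t)" using assms chr_chi by auto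
  have eq: "F (chi 0 t s) s = F 0 t" using F_restrict[OF t c, of s] assms by (simp add: F_def)
  have nn: "chi 0 t s \<ge> 0" using characteristic_nonneg[OF c, of s] assms by auto
  show "F 0 s \<le> F 0 t" using F_mono[OF assms(1) _ nn] eq by simp
  have "chi 0 t s \<le> t - s" using chr_slope[OF c, of s t] assms characteristic_end[OF c] by simp
  then show "F 0 t - F 0 s \<le> t - s" using F_lipschitz[OF assms(1) _ nn] eq by simp
qed

lemma F0_continuous: "continuous_on {0..} (F 0)"
proof (rule continuous_onI)
  fix x e :: real assume "x \<in> {0..}" "e > 0"
  have "\<bar>F 0 y - F 0 x\<bar> \<le> \<bar>y - x\<bar>" if "y \<ge> 0" for y
    using F0_mono[of x y] F0_mono[of y x] \<open>x \<in> {0..}\<close> that by (cases "x \<le> y") auto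
  then show "\<exists>d>0. \<forall>x'\<in>{0..}. dist x' x < d \<longrightarrow> dist (F 0 x') (F 0 x) \<le> e"
    using \<open>e > 0\<close> by (intro exI[of _ e]) (fastforce simp: dist_real_def)
qed

end

section \<open>Absorption times\<close>

context lsw_sol
begin

text \<open>Since \<open>w\<close> is constant along characteristics, the mass bound holds at all
  earlier times with the same value \<open>w0 z\<close>: a live particle has size at most
  \<open>1 / w0 z\<close>.\<close>

lemma alive_chr:
  assumes t: "t \<ge> 0" and z: "F 0 t \<le> z" "w0 z > 0"
  obtains x \<xi> where "chr x t \<xi>" "\<xi> 0 = z" "\<And>s. s \<in> {0..t} \<Longrightarrow> \<xi> s * w0 z \<le> 1"
proof -
  obtain x where x: "0 \<le> x" "F x t = z" using alive[OF t z] by blast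
  have c: "chr x t (chi x t)" using chr_chi[OF t x(1)] .
  have z0: "chi x t 0 = z" using x by (simp add: F_def)
  have "chi x t s * w0 z \<le> 1" if s: "s \<in> {0..t}" for s
  proof -
    have "chi x t s \<ge> 0" using characteristic_nonneg[OF c s] .
    then show ?thesis
      using times_w_le[of s "chi x t s"] w_eq[of s "chi x t s"] F_restrict[OF t c s] z0 s by simp
  qed
  then show ?thesis using that[OF c z0] by blast
qed

lemma L_le_alive:
  assumes "0 \<le> s" "F 0 s \<le> z" "w0 z > 0"
  shows "L s \<le> 3 * (1 / w0 z)"
proof -
  have "w0 z \<le> w 0 s" using w0_antimono[of "F 0 s" z] w_eq[of s 0] F_nonneg[of s 0] assms by simp
  then have "3 / w 0 s \<le> 3 / w0 z" using assms by (intro divide_left_mono) auto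
  then show ?thesis using L_le[OF assms(1)] by simp
qed

text \<open>\<open>gap_growth\<close> is applied from time 0, where the gap is
  \<open>z' - z\<close>, with \<open>1 / w0 z'\<close> as the bound for sizes and, up to the factor
  3, for \<open>L\<close>.\<close>

lemma absorption_bound:
  assumes t: "t \<ge> 0" and z: "F 0 t \<le> z" "z < z'" "w0 z' > 0"
  shows "(z' - z) * exp (t * w0 z' / 6) \<le> 1 / w0 z'"
proof -
  have z0: "z \<ge> 0" using F_nonneg[OF t, of 0] z by simp
  then have wz: "w0 z > 0" using w0_antimono[of z z'] z by simp
  obtain x \<xi> where \<xi>: "chr x t \<xi>" "\<xi> 0 = z" using alive_chr[OF t z(1) wz] by blast
  have "F 0 t \<le> z'" using z by simp
  then obtain y \<eta> where \<eta>: "chr y t \<eta>" "\<eta> 0 = z'" "\<And>s. s \<in> {0..t} \<Longrightarrow> \<eta> s * w0 z' \<le> 1"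
    using alive_chr[OF t _ z(3)] by blast
  have "(\<eta> 0 - \<xi> 0) * exp ((t - 0) / (6 * (1 / w0 z'))) \<le> 1 / w0 z'"
  proof (rule gap_growth[OF \<xi>(1) \<eta>(1)])
    fix s assume s: "s \<in> {0..t}"
    show "\<eta> s \<le> 1 / w0 z'" using \<eta>(3)[OF s] z by (simp add: field_simps)
    show "L s \<le> 3 * (1 / w0 z')" using F0_mono(1)[of s t] s z by (intro L_le_alive) auto
  qed (use t z \<xi> \<eta> in auto)
  then show ?thesis using \<xi> \<eta> by simp
qed

lemma absorption_time_bound:
  assumes t: "t \<ge> 0" and z: "F 0 t \<le> z" "z < z'" "w0 z' > 0"
  shows "t \<le> 6 / w0 z' * ln (1 / (w0 z' * (z' - z)))"
proof -
  have "exp (t * w0 z' / 6) \<le> 1 / (w0 z' * (z' - z))"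
    using absorption_bound[OF assms] z by (simp add: field_simps)
  then have "t * w0 z' / 6 \<le> ln (1 / (w0 z' * (z' - z)))"
    using z by (subst ln_ge_iff) auto
  then show ?thesis using z by (simp add: field_simps)
qed

text \<open>There are three phases. Until \<open>tp\<close> the cross ratio of the labels controls
  the ratio of the gaps above and below \<rho>. From \<open>tp\<close> to \<open>tq\<close> this
  control survives up to a factor because \<rho> stays away from 0. At \<open>tq\<close> it becomes
  a lower bound for the gap above \<rho>, whose exponential growth limits
  \<open>tr - tq\<close>.\<close>

lemma absorption_step:
  assumes t: "0 \<le> tp" "tp \<le> tq" "tq \<le> tr"
    and F: "F 0 tp = p" "F 0 tq = q" "F 0 tr = r"
    and less: "p < q" "q < r" "r < s"
    and \<kappa>: "\<kappa> > 0" and K: "K > 0" "w0 p > 0" "w0 s \<ge> K * w0 p"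
    and mass: "tail_int w0 p \<le> 4 * w0 p * (r - q)"
    and cr: "\<kappa> / 6 \<le> (q - p) * (s - r) / ((r - p) * (s - q))"
  shows "tr - tq \<le> 6 * ln (30 * exp (15 / K) / (\<kappa> * K)) / w0 s"
proof -
  define W where "W = w0 p"
  have W: "W > 0" and ws: "w0 s \<ge> K * W" using K by (auto simp: W_def)
  have wspos: "w0 s > 0" using ws K W by (smt (verit) mult_pos_pos)
  have p0: "p \<ge> 0" using F_nonneg[of tp 0] F t by simp
  have tq: "0 \<le> tq" and tr: "0 \<le> tr" using t by auto
  define \<pi> \<phi> \<rho> where "\<pi> = chi 0 tp" and "\<phi> = chi 0 tq" and "\<rho> = chi 0 tr"
  have c\<pi>: "chr 0 tp \<pi>" "\<pi> 0 = p" using chr_chi[OF t(1), of 0] F(1) by (auto simp: \<pi>_def F_def)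
  have c\<phi>: "chr 0 tq \<phi>" "\<phi> 0 = q" using chr_chi[OF tq, of 0] F(2) by (auto simp: \<phi>_def F_def)
  have c\<rho>: "chr 0 tr \<rho>" "\<rho> 0 = r" using chr_chi[OF tr, of 0] F(3) by (auto simp: \<rho>_def F_def)
  have "F 0 tr \<le> s" using F less by simp
  then obtain x \<sigma> where c\<sigma>: "chr x tr \<sigma>" "\<sigma> 0 = s" and \<sigma>_le: "\<And>u. u \<in> {0..tr} \<Longrightarrow> \<sigma> u * w0 s \<le> 1"
    using alive_chr[OF tr _ wspos] by blast
  have cp: "chr 0 tp \<pi>" "chr (\<phi> tp) tp \<phi>" "chr (\<rho> tp) tp \<rho>" "chr (\<sigma> tp) tp \<sigma>"
    using c\<pi> characteristic_restrict[OF c\<phi>(1), of tp] characteristic_restrict[OF c\<rho>(1), of tp]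
      characteristic_restrict[OF c\<sigma>(1), of tp] t by auto
  have cq: "chr (\<phi> tq) tq \<phi>" "chr (\<rho> tq) tq \<rho>" "chr (\<sigma> tq) tq \<sigma>"
    using characteristic_restrict[OF c\<phi>(1), of tq] characteristic_restrict[OF c\<rho>(1), of tq]
      characteristic_restrict[OF c\<sigma>(1), of tq] t by auto
  have l: "0 < \<phi> tp" "\<phi> tp < \<rho> tp" "\<rho> tp < \<sigma> tp" "\<rho> tq < \<sigma> tq"
    using chr_less_forward[OF cp(1,2), of 0 tp] chr_less_forward[OF cp(2,3), of 0 tp]
      chr_less_forward[OF cp(3,4), of 0 tp] chr_less_forward[OF cq(2,3), of 0 tq]
      c\<pi> c\<phi> c\<rho> c\<sigma> less t characteristic_end[OF c\<pi>(1)] by auto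
  \<comment> \<open>At \<open>tp\<close> the lowest of the four characteristics is at 0; bounding
    \<open>\<phi> tp / \<rho> tp\<close> by 1 and shortening \<open>\<sigma> tp - \<phi> tp\<close>
    in the denominator leaves the ratio of adjacent gaps.\<close>
  have "\<kappa> / 6 \<le> (\<phi> tp - 0) * (\<sigma> tp - \<rho> tp) / ((\<rho> tp - 0) * (\<sigma> tp - \<phi> tp))"
    using order_trans[OF cr cross_ratio_mono[OF cp, unfolded c\<pi>(2) c\<phi>(2) c\<rho>(2) c\<sigma>(2), OF less t(1)]] .
  also have "\<dots> = (\<phi> tp / \<rho> tp) * ((\<sigma> tp - \<rho> tp) / (\<sigma> tp - \<phi> tp))" by simp
  also have "\<dots> \<le> 1 * ((\<sigma> tp - \<rho> tp) / (\<rho> tp - \<phi> tp))"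
    using l by (intro mult_mono divide_left_mono mult_pos_pos) auto
  finally have r1: "\<kappa> / 6 \<le> (\<sigma> tp - \<rho> tp) / (\<rho> tp - \<phi> tp)" by simp
  \<comment> \<open>Conservation of mass through \<open>chord_mass\<close>: \<open>w 0 u\<close>
    contributes at most \<open>W\<close> and the tail term at most \<open>4 * W\<close>, hence the
    5.\<close>
  have \<rho>_ge: "1 / (5 * W) \<le> \<rho> u" if u: "u \<in> {tp..tq}" for u
  proof -
    have u0: "0 \<le> u" "u \<in> {0..tr}" using u t by auto
    have f: "p \<le> F 0 u" "F 0 u \<le> q" using F0_mono(1)[of tp u] F0_mono(1)[of u tq] u t F by auto
    have Fr: "F (\<rho> u) u = r" using F_restrict[OF tr c\<rho>(1) u0(2)] c\<rho> by simp
    have "\<rho> u \<ge> 0" using characteristic_nonneg[OF c\<rho>(1) u0(2)] .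
    moreover have "\<rho> u \<noteq> 0" using Fr f less by auto
    ultimately have pos: "\<rho> u > 0" by simp
    have "tail_int w0 (F 0 u) \<le> tail_int w0 p"
      using tail_int_antimono_bounds(1)[OF init p0 f(1)] .
    also have "\<dots> \<le> 4 * W * (r - F 0 u)"
    proof -
      have "4 * W * (r - q) \<le> 4 * W * (r - F 0 u)" using W f by (intro mult_left_mono) auto
      then show ?thesis using mass by (simp add: W_def)
    qed
    finally have "tail_int w0 (F 0 u) / (r - F 0 u) \<le> 4 * W" using f less by (simp add: divide_simps)
    moreover have "w 0 u \<le> W" using w_eq[OF u0(1), of 0] w0_antimono[OF p0 f(1)] by (simp add: W_def)
    ultimately have "w 0 u + tail_int w0 (F 0 u) / (r - F 0 u) \<le> 5 * W" by simp
    then have "\<rho> u * (w 0 u + tail_int w0 (F 0 u) / (r - F 0 u)) \<le> \<rho> u * (5 * W)"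
      using pos by (intro mult_left_mono) auto
    then have "1 \<le> \<rho> u * (5 * W)" using chord_mass[OF u0(1) pos] Fr by simp
    then show ?thesis using W by (simp add: divide_simps mult.commute)
  qed
  have \<phi>0: "\<phi> tq = 0" using characteristic_end[OF c\<phi>(1)] .
  have "(\<sigma> tp - \<rho> tp) / (\<rho> tp - \<phi> tp) * exp (- 3 * \<sigma> tq / (1 / (5 * W))) \<le> (\<sigma> tq - \<rho> tq) / (\<rho> tq - \<phi> tq)"
    using l t W \<rho>_ge by (intro ratio_after_first_absorption[OF cq]) auto
  \<comment> \<open>A live \<sigma> has size at most \<open>1 / (K * W)\<close>, so the exponent is
    at least \<open>- 3 * 5 / K\<close>.\<close>
  moreover have "\<kappa> / 6 * exp (- (15 / K)) \<le> (\<sigma> tp - \<rho> tp) / (\<rho> tp - \<phi> tp) * exp (- 3 * \<sigma> tq / (1 / (5 * W)))"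
  proof (rule mult_mono[OF r1])
    have \<sigma>0: "\<sigma> tq \<ge> 0" using characteristic_nonneg[OF c\<sigma>(1), of tq] t by simp
    have "\<sigma> tq * (K * W) \<le> \<sigma> tq * w0 s" using ws \<sigma>0 by (intro mult_left_mono)
    also have "\<dots> \<le> 1" using \<sigma>_le[of tq] t by simp
    finally have "\<sigma> tq * W \<le> 1 / K" using K(1) by (simp add: field_simps)
    then show "exp (- (15 / K)) \<le> exp (- 3 * \<sigma> tq / (1 / (5 * W)))" by simp
  qed (use l in auto)
  ultimately have "\<kappa> / 6 * exp (- (15 / K)) \<le> (\<sigma> tq - \<rho> tq) / (\<rho> tq - \<phi> tq)" by (rule order_trans[rotated])
  \<comment> \<open>At \<open>tq\<close> the particle \<phi> is at 0, so the denominator of the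
    ratio is \<open>\<rho> tq\<close>, which is at least \<open>1 / (5 * W)\<close>.\<close>
  then have "\<kappa> / 6 * exp (- (15 / K)) \<le> (\<sigma> tq - \<rho> tq) / \<rho> tq" by (simp only: \<phi>0 diff_zero)
  have \<rho>tq: "1 / (5 * W) \<le> \<rho> tq" "\<rho> tq > 0"
    using \<rho>_ge[of tq] t W by (auto intro: less_le_trans[of 0 "1 / (5 * W)"])
  with \<open>\<kappa> / 6 * exp (- (15 / K)) \<le> (\<sigma> tq - \<rho> tq) / \<rho> tq\<close>
  have "\<kappa> / 6 * exp (- (15 / K)) * \<rho> tq \<le> \<sigma> tq - \<rho> tq" by (simp add: pos_le_divide_eq)
  moreover have "\<kappa> / 6 * exp (- (15 / K)) * (1 / (5 * W)) \<le> \<kappa> / 6 * exp (- (15 / K)) * \<rho> tq"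
    using \<rho>tq \<kappa> by (intro mult_left_mono) auto
  ultimately have gap: "\<kappa> * exp (- (15 / K)) / (30 * W) \<le> \<sigma> tq - \<rho> tq" by simp
  have "(\<sigma> tq - \<rho> tq) * exp ((tr - tq) / (6 * (1 / w0 s))) \<le> 1 / w0 s"
  proof (rule gap_growth[OF c\<rho>(1) c\<sigma>(1)])
    fix u assume u: "u \<in> {tq..tr}"
    show "\<sigma> u \<le> 1 / w0 s" using \<sigma>_le[of u] u tq wspos by (simp add: field_simps)
    have "F 0 u \<le> s" using F0_mono(1)[of u tr] u tq F less by simp
    then show "L u \<le> 3 * (1 / w0 s)" using u tq wspos by (intro L_le_alive) auto
  qed (use l t tq wspos in auto)
  also have "\<dots> \<le> 1 / (K * W)" using ws K W wspos by (intro divide_left_mono) auto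
  finally have "(\<sigma> tq - \<rho> tq) * exp ((tr - tq) * w0 s / 6) \<le> 1 / (K * W)" by simp
  moreover have "\<kappa> * exp (- (15 / K)) / (30 * W) * exp ((tr - tq) * w0 s / 6) \<le> (\<sigma> tq - \<rho> tq) * exp ((tr - tq) * w0 s / 6)"
    using gap by (intro mult_right_mono) auto
  ultimately have "\<kappa> * exp (- (15 / K)) / (30 * W) * exp ((tr - tq) * w0 s / 6) \<le> 1 / (K * W)" by linarith
  then have "exp ((tr - tq) * w0 s / 6) \<le> 30 * exp (15 / K) / (\<kappa> * K)"
    using W K \<kappa> by (simp add: field_simps exp_minus)
  then have "(tr - tq) * w0 s / 6 \<le> ln (30 * exp (15 / K) / (\<kappa> * K))"
    using K \<kappa> by (subst ln_ge_iff) auto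
  then show ?thesis using wspos by (simp add: field_simps)
qed

text \<open>\<open>T\<close> is compared with the absorption times \<tau> of the labels
  \<open>z j\<close>. The first summand accounts for the time until \<open>z 1\<close> is absorbed,
  the second for the later waiting times, which are of order \<open>1 / w0 (z j)\<close> and hence
  dominated by a geometric series.\<close>

theorem growth_from_chain:
  fixes z :: "nat \<Rightarrow> real"
  assumes z0: "z 0 \<ge> 0"
    and z_Suc: "\<And>j. z (Suc j) = z j + tail_int w0 (z j) / (2 * w0 (z j))"
    and w_pos: "\<And>j. w0 (z j) > 0"
    and \<kappa>: "\<kappa> > 0" "\<kappa> \<le> 1" and \<theta>: "\<theta> > 0" "\<theta> < 1"
    and w_ge: "\<And>j. \<kappa> * w0 (z j) \<le> w0 (z (Suc j))"
    and w_le: "\<And>j. w0 (z (Suc j)) \<le> \<theta> * w0 (z j)"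
    and T: "T \<ge> 0"
  shows "T * w 0 T \<le> \<bar>6 / w0 (z 2) * ln (1 / (w0 (z 2) * (z 2 - z 1)))\<bar> * w0 0
      + 6 * \<bar>ln (30 * exp (15 / \<kappa>^3) / (\<kappa> * \<kappa>^3))\<bar> / \<kappa>\<^sup>2 / (1 - \<theta>)"
proof -
  define d where "d = (\<lambda>j. z (Suc j) - z j)"
  define C where "C = 6 * \<bar>ln (30 * exp (15 / \<kappa>^3) / (\<kappa> * \<kappa>^3))\<bar>"
  \<comment> \<open>The solution of \<open>A * \<theta> + C / \<kappa>^2 = A\<close>, which makes
    the induction for \<open>bound\<close> close.\<close>
  define A where "A = C / \<kappa>\<^sup>2 / (1 - \<theta>)"
  define T0 where "T0 = \<bar>6 / w0 (z 2) * ln (1 / (w0 (z 2) * (z 2 - z 1)))\<bar>"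
  have nn: "0 \<le> z j" "0 \<le> d j" for j
  proof -
    show "0 \<le> z j"
    proof (induction j)
      case (Suc j)
      then show ?case
        using z_Suc[of j] tail_int_antimono_bounds(2)[OF init Suc order_refl] w_pos[of j] by simp
    qed (use z0 in simp)
    then show "0 \<le> d j"
      using z_Suc[of j] tail_int_antimono_bounds(2)[OF init _ order_refl] w_pos[of j] by (simp add: d_def)
  qed
  have d_pos: "d j > 0" for j
  proof -
    have "\<theta> * w0 (z j) < 1 * w0 (z j)" using w_pos[of j] \<theta> by (intro mult_strict_right_mono) auto
    then have "d j \<noteq> 0" using w_le[of j] by (auto simp: d_def)
    then show ?thesis using nn(2)[of j] by simp
  qed
  have tail_eq: "tail_int w0 (z j) = 2 * w0 (z j) * d j" for j
    using z_Suc[of j] w_pos[of j] by (simp add: d_def)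
  \<comment> \<open>One step removes at most \<open>d j * w0 (z j)\<close>, which is half of the
    tail integral, and \<open>w0\<close> does not increase.\<close>
  have d_half: "d j / 2 \<le> d (Suc j)" for j
  proof -
    have "tail_int w0 (z j) - tail_int w0 (z (Suc j)) \<le> d j * w0 (z j)"
      using tail_int_antimono_bounds(3)[OF init nn(1)[of j], of "z (Suc j)"] nn(2)[of j] by (simp add: d_def)
    then have "w0 (z j) * d j \<le> 2 * w0 (z (Suc j)) * d (Suc j)"
      by (simp add: tail_eq mult.commute)
    also have "\<dots> \<le> 2 * w0 (z j) * d (Suc j)"
      using w0_antimono[OF nn(1)[of j], of "z (Suc j)"] nn(2)[of j] nn(2)[of "Suc j"]
      by (intro mult_right_mono) (auto simp: d_def)
    finally have "w0 (z j) * d j \<le> w0 (z j) * (2 * d (Suc j))" by simp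
    then show ?thesis using w_pos[of j] by simp
  qed
  \<comment> \<open>The tail integral does not increase, while \<open>w0\<close> keeps at least the
    fraction \<kappa> of its value.\<close>
  have d_le: "\<kappa> * d (Suc j) \<le> d j" for j
  proof -
    have "2 * (\<kappa> * w0 (z j)) * d (Suc j) \<le> 2 * w0 (z (Suc j)) * d (Suc j)"
      using w_ge[of j] nn(2) by (intro mult_right_mono) auto
    also have "\<dots> \<le> 2 * w0 (z j) * d j"
      using tail_int_antimono_bounds(1)[OF init nn(1)[of j], of "z (Suc j)"] nn(2)[of j]
      unfolding tail_eq by (simp add: d_def)
    finally have "w0 (z j) * (\<kappa> * d (Suc j)) \<le> w0 (z j) * d j" by (simp add: mult.left_commute)
    then show ?thesis using w_pos[of j] by simp
  qed
  \<comment> \<open>If \<open>z j\<close> were still alive at a time beyond \<open>u\<close>, the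
    bound on absorption times would be violated. Hence \<open>F 0\<close> reaches \<open>z j\<close>
    in finite time.\<close>
  have ex: "\<exists>t\<ge>0. F 0 t = z j" for j
  proof -
    define u where "u = 6 / w0 (z (Suc j)) * ln (1 / (w0 (z (Suc j)) * (z (Suc j) - z j)))"
    define t where "t = \<bar>u\<bar> + 1"
    have t: "t \<ge> 0" "\<not> t \<le> u" by (auto simp: t_def)
    have "z j < z (Suc j)" using d_pos[of j] by (simp add: d_def)
    then have "\<not> F 0 t \<le> z j"
      using absorption_time_bound[OF t(1) _ _ w_pos, of "z j" "Suc j"] t(2) unfolding u_def by blast
    then have "z j \<le> F 0 t" by simp
    moreover have "F 0 0 \<le> z j" using F_0[of 0] nn(1)[of j] by simp
    moreover have "continuous_on {0..t} (F 0)" by (rule continuous_on_subset[OF F0_continuous]) auto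
    ultimately show ?thesis using IVT'[of "F 0" 0 "z j" t] t(1) by blast
  qed
  then obtain \<tau> where \<tau>: "\<And>j. \<tau> j \<ge> 0" "\<And>j. F 0 (\<tau> j) = z j" by metis
  have \<tau>_less: "t < \<tau> j" if "t \<ge> 0" "F 0 t < z j" for t j
  proof (rule ccontr)
    assume "\<not> t < \<tau> j"
    then have "F 0 (\<tau> j) \<le> F 0 t" using \<tau>(1)[of j] by (intro F0_mono(1)) auto
    then show False using \<tau>(2)[of j] that by simp
  qed
  have \<tau>_mono: "\<tau> j \<le> \<tau> (Suc j)" for j
    using \<tau>_less[of "\<tau> j" "Suc j"] \<tau> d_pos[of j] by (simp add: d_def less_imp_le)
  \<comment> \<open>The labels \<open>z j\<close> to \<open>z (j + 3)\<close> play the roles of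
    \<open>p\<close>, \<open>q\<close>, \<open>r\<close>, \<open>s\<close>; three steps separate the
    outer ones, hence \<open>\<kappa>^3\<close>.\<close>
  have step: "\<tau> (Suc (Suc j)) \<le> \<tau> (Suc j) + C / w0 (z (j + 3))" for j
  proof -
    have eq: "z (Suc j) = z j + d j" "z (Suc (Suc j)) = z j + d j + d (Suc j)"
      "z (j + 3) = z j + d j + d (Suc j) + d (Suc (Suc j))"
      by (simp_all add: d_def numeral_3_eq_3)
    have "\<tau> (Suc (Suc j)) - \<tau> (Suc j) \<le> 6 * ln (30 * exp (15 / \<kappa>^3) / (\<kappa> * \<kappa>^3)) / w0 (z (j + 3))"
    proof (rule absorption_step[OF \<tau>(1) \<tau>_mono \<tau>_mono \<tau>(2) \<tau>(2) \<tau>(2)])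
      have "\<kappa> ^ 3 * w0 (z j) = \<kappa> * (\<kappa> * (\<kappa> * w0 (z j)))" by (simp add: power3_eq_cube)
      also have "\<dots> \<le> \<kappa> * (\<kappa> * w0 (z (Suc j)))" using w_ge \<kappa> by simp
      also have "\<dots> \<le> \<kappa> * w0 (z (Suc (Suc j)))" using w_ge \<kappa> by simp
      also have "\<dots> \<le> w0 (z (j + 3))" using w_ge[of "Suc (Suc j)"] by (simp add: numeral_3_eq_3)
      finally show "\<kappa> ^ 3 * w0 (z j) \<le> w0 (z (j + 3))" .
      have "tail_int w0 (z j) \<le> 2 * w0 (z j) * (2 * d (Suc j))"
        unfolding tail_eq using d_half[of j] w_pos[of j] by (intro mult_left_mono) auto
      then show "tail_int w0 (z j) \<le> 4 * w0 (z j) * (z (Suc (Suc j)) - z (Suc j))"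
        by (simp add: d_def algebra_simps)
      \<comment> \<open>The cross ratio is a product of two quotients. The first is at least
        \<open>\<kappa> / 2\<close> because steps grow at most by \<open>1 / \<kappa>\<close>, the
        second at least \<open>1 / 3\<close> because steps shrink at most by half.\<close>
      have "\<kappa> * d (Suc j) \<le> d j" "d (Suc j) \<le> 2 * d (Suc (Suc j))" using d_le d_half[of "Suc j"] by auto
      moreover have "\<kappa> * d j \<le> d j" using \<kappa> d_pos[of j] by simp
      ultimately have "\<kappa> * d j + \<kappa> * d (Suc j) \<le> d j * 2" "d (Suc j) \<le> 2 * d (Suc (Suc j))" by linarith+
      then have 1: "\<kappa> / 2 \<le> d j / (d j + d (Suc j))" "1 / 3 \<le> d (Suc (Suc j)) / (d (Suc j) + d (Suc (Suc j)))"
        using d_pos[of j] d_pos[of "Suc j"] d_pos[of "Suc (Suc j)"] by (simp_all add: field_simps)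
      have "\<kappa> / 2 * (1 / 3) \<le> d j / (d j + d (Suc j)) * (d (Suc (Suc j)) / (d (Suc j) + d (Suc (Suc j))))"
        using 1 \<kappa> d_pos[of j] d_pos[of "Suc j"] by (intro mult_mono) auto
      then show "\<kappa> / 6 \<le> (z (Suc j) - z j) * (z (j + 3) - z (Suc (Suc j))) / ((z (Suc (Suc j)) - z j) * (z (j + 3) - z (Suc j)))"
        unfolding eq by simp
    qed (use \<kappa> w_pos d_pos in \<open>simp_all add: eq\<close>)
    also have "\<dots> \<le> C / w0 (z (j + 3))"
      unfolding C_def using w_pos[of "j + 3"] by (intro divide_right_mono mult_left_mono) auto
    finally show ?thesis by simp
  qed
  have C0: "C \<ge> 0" by (simp add: C_def)
  have A0: "A \<ge> 0" using C0 \<theta> by (simp add: A_def)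
  have "\<tau> 1 \<le> 6 / w0 (z 2) * ln (1 / (w0 (z 2) * (z 2 - z 1)))"
    using absorption_time_bound[OF \<tau>(1), of 1 "z 1" "z 2"] \<tau>(2)[of 1] d_pos[of 1] w_pos
    by (simp add: d_def numeral_2_eq_2)
  then have \<tau>1: "\<tau> 1 \<le> T0" unfolding T0_def by linarith
  \<comment> \<open>Since \<open>w0\<close> drops at least by the factor \<theta> in each step, the
    accumulated time is comparable with its last contribution.\<close>
  have bound: "\<tau> (Suc j) \<le> T0 + A / w0 (z j)" for j
  proof (induction j)
    case 0
    have "A / w0 (z 0) \<ge> 0" using A0 w_pos[of 0] by simp
    then show ?case using \<tau>1 by simp
  next
    case (Suc j)
    have "A / w0 (z j) \<le> A * \<theta> / w0 (z (Suc j))"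
      using w_le[of j] w_pos[of j] w_pos[of "Suc j"] A0 mult_left_mono[OF w_le[of j] A0]
      by (simp add: divide_simps mult_ac)
    moreover have "C / w0 (z (j + 3)) \<le> C / \<kappa>\<^sup>2 / w0 (z (Suc j))"
    proof -
      have "\<kappa>\<^sup>2 * w0 (z (Suc j)) = \<kappa> * (\<kappa> * w0 (z (Suc j)))" by (simp add: power2_eq_square)
      also have "\<dots> \<le> \<kappa> * w0 (z (Suc (Suc j)))" using w_ge \<kappa> by simp
      also have "\<dots> \<le> w0 (z (j + 3))" using w_ge[of "Suc (Suc j)"] by (simp add: numeral_3_eq_3)
      finally have "C / w0 (z (j + 3)) \<le> C / (\<kappa>\<^sup>2 * w0 (z (Suc j)))"
        using \<kappa> w_pos C0 by (intro divide_left_mono) auto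
      then show ?thesis by simp
    qed
    moreover have "A * \<theta> / w0 (z (Suc j)) + C / \<kappa>\<^sup>2 / w0 (z (Suc j)) = A / w0 (z (Suc j))"
    proof -
      have "A * \<theta> + C / \<kappa>\<^sup>2 = A"
      proof -
        have "A * (1 - \<theta>) = C / \<kappa>\<^sup>2" using \<theta> by (simp add: A_def)
        then show ?thesis by (simp add: algebra_simps)
      qed
      then show ?thesis by (metis add_divide_distrib)
    qed
    ultimately show ?case using step[of j] Suc by simp
  qed
  have wT: "w 0 T > 0" "w 0 T = w0 (F 0 T)" using w_0_pos[OF T] w_eq[OF T, of 0] by auto
  have w_pow: "w0 (z j) \<le> \<theta> ^ j * w0 (z 0)" for j
  proof (induction j)
    case (Suc j)
    have "w0 (z (Suc j)) \<le> \<theta> * w0 (z j)" by (rule w_le)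
    also have "\<dots> \<le> \<theta> * (\<theta> ^ j * w0 (z 0))" using Suc \<theta> by (intro mult_left_mono) auto
    finally show ?case by simp
  qed simp
  \<comment> \<open>\<open>w0 (z j)\<close> tends to 0 while \<open>w 0 T\<close> is positive, so
    the chain eventually passes the label \<open>F 0 T\<close>.\<close>
  have "(\<lambda>j. \<theta> ^ j * w0 (z 0)) \<longlonglongrightarrow> 0 * w0 (z 0)"
    using \<theta> by (intro tendsto_mult LIMSEQ_realpow_zero tendsto_const) auto
  then have "eventually (\<lambda>j. \<theta> ^ j * w0 (z 0) < w 0 T) sequentially"
    using wT by (intro order_tendstoD(2)[where y="0 * w0 (z 0)"]) auto
  then obtain J where "\<theta> ^ J * w0 (z 0) < w 0 T" by (auto simp: eventually_sequentially)
  then have "w0 (z J) < w0 (F 0 T)" using w_pow[of J] wT by simp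
  then have "F 0 T < z J" using w0_antimono[of "z J" "F 0 T"] nn(1)[of J] by (meson not_le)
  then have "F 0 T < z (Suc J)" using d_pos[of J] by (simp add: d_def)
  \<comment> \<open>By minimality \<open>z j \<le> F 0 T\<close> unless \<open>j = 0\<close>, so
    \<open>1 / w0 (z j) \<le> 1 / w 0 T\<close>; for \<open>j = 0\<close> the bound on
    \<open>\<tau> 1\<close> suffices.\<close>
  define j where "j = (LEAST j. F 0 T < z (Suc j))"
  have j: "F 0 T < z (Suc j)" unfolding j_def by (rule LeastI[of _ J]) fact
  have "T \<le> T0 + A / w 0 T"
  proof (cases j)
    case 0
    then have "T \<le> \<tau> 1" using \<tau>_less[OF T j] by simp
    moreover have "A / w 0 T \<ge> 0" using A0 wT by simp
    ultimately show ?thesis using \<tau>1 by linarith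
  next
    case (Suc i)
    then have "\<not> F 0 T < z (Suc i)" using not_less_Least[of i "\<lambda>j. F 0 T < z (Suc j)"] by (simp add: j_def)
    then have "w 0 T \<le> w0 (z j)" using w0_antimono[of "z j" "F 0 T"] nn(1)[of j] Suc wT by simp
    then have "A / w0 (z j) \<le> A / w 0 T" using A0 wT w_pos[of j] by (intro divide_left_mono) auto
    then show ?thesis using \<tau>_less[OF T j] bound[of j] by linarith
  qed
  then have "T * w 0 T \<le> (T0 + A / w 0 T) * w 0 T" using wT by (intro mult_right_mono) auto
  also have "\<dots> = T0 * w 0 T + A" using wT by (simp add: distrib_right)
  also have "\<dots> \<le> T0 * w0 0 + A"
  proof -
    have "T0 \<ge> 0" by (simp add: T0_def)
    then show ?thesis using wT w0_antimono[of 0 "F 0 T"] F_nonneg[OF T, of 0] by (simp add: mult_left_mono)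
  qed
  finally show ?thesis unfolding T0_def A_def C_def .
qed

end

section \<open>The mean volume\<close>

text \<open>Writing the derivative as a limit of a sequence of difference quotients yields
  measurability and sign of the density.\<close>

lemma DERIV_sequentially:
  assumes "(v has_real_derivative D) (at x)"
  shows "(\<lambda>n. (v x - v (x + 1 / real (Suc n))) * real (Suc n)) \<longlonglongrightarrow> - D"
proof -
  have "filterlim (\<lambda>n. 1 / real (Suc n)) (at 0) sequentially"
    by (intro filterlim_atI LIMSEQ_Suc[OF lim_1_over_n] always_eventually) auto
  moreover have "(\<lambda>h. (v (x + h) - v x) / h) \<midarrow>0\<rightarrow> D"
    using assms by (simp add: DERIV_def)
  ultimately have "(\<lambda>n. (v (x + 1 / real (Suc n)) - v x) / (1 / real (Suc n))) \<longlonglongrightarrow> D"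
    using filterlim_compose by blast
  from tendsto_minus[OF this] show ?thesis by (simp add: algebra_simps)
qed

text \<open>The finite set \<open>E\<close> is needed because \<open>w\<^sub>0\<close> may fail to be differentiable at the end
  point of its support.\<close>

lemma antimono_density_integrals:
  fixes v :: "real \<Rightarrow> real"
  assumes cont: "continuous_on {0..} v"
    and anti: "\<And>x y. 0 \<le> x \<Longrightarrow> x \<le> y \<Longrightarrow> v y \<le> v x"
    and nonneg: "\<And>x. x \<ge> 0 \<Longrightarrow> v x \<ge> 0"
    and int: "set_integrable lborel {0..} v"
    and E: "finite E" and diff: "\<And>x. x > 0 \<Longrightarrow> x \<notin> E \<Longrightarrow> v differentiable (at x)"
  shows "(LBINT x:{0<..}. - deriv v x) = v 0"
    and "(LBINT x:{0<..}. x * - deriv v x) = (LBINT x:{0..}. v x)"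
proof -
  define S where "S = {0<..} - E"
  \<comment> \<open>The density, set to 0 on the exceptional set and outside the open half
    line.\<close>
  define c where "c = (\<lambda>x. if x \<in> S then - deriv v x else 0)"
  define g where "g = (\<lambda>n x. indicator S x * ((v x - v (x + 1 / real (Suc n))) * real (Suc n)))"
  have dv: "(v has_real_derivative deriv v x) (at x)" if "x \<in> S" for x
    using diff[of x] that by (auto simp: S_def DERIV_deriv_iff_real_differentiable)
  have lim: "(\<lambda>n. g n x) \<longlonglongrightarrow> c x" for x
    using DERIV_sequentially[OF dv, of x] by (cases "x \<in> S") (auto simp: g_def c_def)
  have S: "S \<in> sets borel" using E by (auto simp: S_def finite_imp_closed)
  have g: "g n \<in> borel_measurable borel" for n
  proof -
    have [measurable]: "S \<in> sets borel" by (rule S)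
    have "continuous_on {0<..} (\<lambda>x. v x - v (x + 1 / real (Suc n)))"
      by (intro continuous_intros continuous_on_subset[OF cont] continuous_on_compose2[OF cont]) (auto simp: add_nonneg_nonneg)
    from borel_measurable_continuous_on_indicator[OF borel_open[OF open_greaterThan] this]
    have "(\<lambda>x. indicator {0<..} x * (v x - v (x + 1 / real (Suc n)))) \<in> borel_measurable borel" by simp
    then have "(\<lambda>x. indicator S x * ((indicator {0<..} x * (v x - v (x + 1 / real (Suc n)))) * real (Suc n)))
        \<in> borel_measurable borel"
      by (rule borel_measurable_times[OF borel_measurable_indicator[OF S]
          borel_measurable_times[OF _ borel_measurable_const]])
    also have "(\<lambda>x. indicator S x * ((indicator {0<..} x * (v x - v (x + 1 / real (Suc n)))) * real (Suc n))) = g n"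
      by (auto simp: g_def S_def indicator_def)
    finally show ?thesis .
  qed
  have [measurable]: "c \<in> borel_measurable borel"
    using borel_measurable_LIMSEQ_real[OF lim g] .
  have c0: "c x \<ge> 0" for x
  proof (rule LIMSEQ_le_const[OF lim[of x]])
    show "\<exists>N. \<forall>n\<ge>N. 0 \<le> g n x"
      using anti[of x "x + 1 / real (Suc _)"] by (auto simp: g_def S_def indicator_def)
  qed
  have sub: "continuous_on {0..y} v" for y by (rule continuous_on_subset[OF cont]) auto
  define P where "P = (\<lambda>y. integral {0..y} v)"
  define V where "V = (LBINT x:{0..}. v x)"
  have yv: "y * v y \<le> V" if "y \<ge> 0" for y
    using set_integral_ge_rectangle[OF int nonneg that, of "v y"] anti by (simp add: V_def)
  have vlim: "(v \<longlongrightarrow> 0) at_top"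
  proof (rule tendsto_sandwich)
    show "eventually (\<lambda>y. 0 \<le> v y) at_top"
      by (rule eventually_mono[OF eventually_ge_at_top[of 0]]) (rule nonneg)
    show "eventually (\<lambda>y. v y \<le> V / y) at_top"
      using eventually_gt_at_top[of 0] by (rule eventually_mono) (use yv in \<open>simp add: field_simps\<close>)
    show "((\<lambda>y. V / y) \<longlongrightarrow> 0) at_top" by real_asymp
  qed simp
  have Plim: "(P \<longlongrightarrow> V) at_top"
  proof -
    have "((\<lambda>y. \<integral>x. indicator {..y} x *\<^sub>R (indicator {0..} x *\<^sub>R v x) \<partial>lborel) \<longlongrightarrow> V) at_top"
      unfolding V_def set_lebesgue_integral_def
      using int by (intro tendsto_integral_at_top) (auto simp: set_integrable_def)
    moreover have "(\<integral>x. indicator {..y} x *\<^sub>R (indicator {0..} x *\<^sub>R v x) \<partial>lborel) = P y" for y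
    proof -
      have "(\<integral>x. indicator {..y} x *\<^sub>R (indicator {0..} x *\<^sub>R v x) \<partial>lborel) = (LBINT x:{0..y}. v x)"
        unfolding set_lebesgue_integral_def by (intro Bochner_Integration.integral_cong) (auto simp: indicator_def)
      also have "\<dots> = P y"
        unfolding P_def using set_integrable_subset[OF int, of "{0..y}"] by (intro set_borel_integral_eq_integral) auto
      finally show ?thesis .
    qed
    ultimately show ?thesis by simp
  qed
  \<comment> \<open>On \<open>[y/2,y]\<close> the decreasing \<open>v\<close> is at least
    \<open>v y\<close>. Convergence of \<open>P\<close> then forces \<open>y * v y\<close> to tend
    to 0, which removes the boundary term of the first moment.\<close>
  have half: "y * v y \<le> 2 * (P y - P (y / 2))" if "y \<ge> 0" for y
  proof -
    have i: "v integrable_on {0..y}" using sub by (rule integrable_continuous_interval)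
    have "P (y / 2) + integral {y/2..y} v = P y"
      unfolding P_def using that i by (intro Henstock_Kurzweil_Integration.integral_combine) auto
    moreover have "integral {y/2..y} (\<lambda>_. v y) \<le> integral {y/2..y} v"
      using that anti by (intro integral_le integrable_continuous_interval continuous_on_subset[OF cont]) auto
    ultimately show ?thesis using that by simp
  qed
  have yvlim: "((\<lambda>y. y * v y) \<longlongrightarrow> 0) at_top"
  proof (rule tendsto_sandwich)
    show "eventually (\<lambda>y. 0 \<le> y * v y) at_top"
      by (rule eventually_mono[OF eventually_ge_at_top[of 0]]) (simp add: nonneg)
    show "eventually (\<lambda>y. y * v y \<le> 2 * (P y - P (y / 2))) at_top"
      by (rule eventually_mono[OF eventually_ge_at_top[of 0]]) (rule half)
    have "filterlim (\<lambda>y::real. y / 2) at_top at_top" by real_asymp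
    from filterlim_compose[OF Plim this] have "((\<lambda>y. P (y / 2)) \<longlongrightarrow> V) at_top" .
    from tendsto_mult[OF tendsto_const[of 2] tendsto_diff[OF Plim this]]
    show "((\<lambda>y. 2 * (P y - P (y / 2))) \<longlongrightarrow> 0) at_top" by simp
  qed simp
  have I1: "(c has_integral v 0 - v y) {0..y}" if "y \<ge> 0" for y
  proof -
    have "(c has_integral (- v y) - (- v 0)) {0..y}"
    proof (rule fundamental_theorem_of_calculus_interior_strong[OF E that])
      fix x assume "x \<in> {0<..<y} - E"
      then have "x \<in> S" by (auto simp: S_def)
      then show "((\<lambda>x. - v x) has_vector_derivative c x) (at x)"
        using DERIV_minus[OF dv] by (simp add: c_def has_real_derivative_iff_has_vector_derivative)
    qed (intro continuous_intros sub)
    then show ?thesis by simp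
  qed
  have I2: "((\<lambda>x. x * c x) has_integral P y - y * v y) {0..y}" if "y \<ge> 0" for y
  proof -
    \<comment> \<open>Integration by parts: \<open>P x - x * v x\<close> is an antiderivative of
      \<open>x * c x\<close>.\<close>
    have "((\<lambda>x. x * c x) has_integral (P y - y * v y) - (P 0 - 0 * v 0)) {0..y}"
    proof (rule fundamental_theorem_of_calculus_interior_strong[OF E that])
      fix x assume x: "x \<in> {0<..<y} - E"
      then have xS: "x \<in> S" by (auto simp: S_def)
      have "(P has_real_derivative v x) (at x within {0..y})"
        unfolding P_def using x by (intro integral_has_real_derivative sub) auto
      then have dP: "(P has_real_derivative v x) (at x)" using x by (simp add: at_within_Icc_at)
      have "((\<lambda>x. P x - x * v x) has_real_derivative v x - (1 * v x + deriv v x * x)) (at x)"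
        by (intro DERIV_diff DERIV_mult dP dv[OF xS] DERIV_ident)
      then show "((\<lambda>x. P x - x * v x) has_vector_derivative x * c x) (at x)"
        using xS by (simp add: c_def has_real_derivative_iff_has_vector_derivative mult.commute)
    next
      show "continuous_on {0..y} (\<lambda>x. P x - x * v x)"
        unfolding P_def by (intro continuous_intros sub indefinite_integral_continuous_1 integrable_continuous_interval)
    qed
    then show ?thesis by (simp add: P_def)
  qed
  have eq1: "integral {0..y} c = v 0 - v y" "integral {0..y} (\<lambda>x. x * c x) = P y - y * v y" if "y \<ge> 0" for y
    using I1[OF that] I2[OF that] by (auto intro: integral_unique)
  have "(c has_integral v 0) {0..}"
  proof (rule has_integral_to_inf)
    show "c integrable_on {0..y}" for y
      using I1[of y] by (cases "y \<ge> 0") (auto intro: has_integral_integrable simp: integrable_on_empty)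
    have "((\<lambda>y. v 0 - v y) \<longlongrightarrow> v 0 - 0) at_top" by (intro tendsto_intros vlim)
    then show "((\<lambda>y. integral {0..y} c) \<longlongrightarrow> v 0) at_top"
      by (simp add: filterlim_cong[OF refl refl eventually_mono[OF eventually_ge_at_top[of 0] eq1(1)]])
  qed (rule c0)
  from has_integral_nonneg_lborel(2)[OF this] c0
  have J1: "(LBINT x:{0..}. c x) = v 0" by simp
  have "((\<lambda>x. x * c x) has_integral V) {0..}"
  proof (rule has_integral_to_inf)
    show "(\<lambda>x. x * c x) integrable_on {0..y}" for y
      using I2[of y] by (cases "y \<ge> 0") (auto intro: has_integral_integrable simp: integrable_on_empty)
    have "((\<lambda>y. P y - y * v y) \<longlongrightarrow> V - 0) at_top" by (intro tendsto_intros Plim yvlim)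
    then show "((\<lambda>y. integral {0..y} (\<lambda>x. x * c x)) \<longlongrightarrow> V) at_top"
      by (simp add: filterlim_cong[OF refl refl eventually_mono[OF eventually_ge_at_top[of 0] eq1(2)]])
  qed (use c0 in auto)
  from has_integral_nonneg_lborel(2)[OF this] c0
  have J2: "(LBINT x:{0..}. x * c x) = V" by simp
  have "(LBINT x:{0<..}. f x * - deriv v x) = (LBINT x:{0..}. f x * c x)" for f :: "real \<Rightarrow> real"
    unfolding set_lebesgue_integral_def
  proof (rule integral_discrete_difference[where X="insert 0 E"])
    show "countable (insert 0 E)" using E by (simp add: countable_finite)
  qed (auto simp: indicator_def c_def S_def)
  from this[of "\<lambda>_. 1"] this[of "\<lambda>x. x"] J1 J2
  show "(LBINT x:{0<..}. - deriv v x) = v 0"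
    and "(LBINT x:{0<..}. x * - deriv v x) = (LBINT x:{0..}. v x)"
    by (simp_all add: V_def)
qed

section \<open>Differentiability of the backward flow in space\<close>

lemma kern_diag_lipschitz:
  assumes m: "0 < m" "m \<le> x" "m \<le> y"
  shows "\<bar>kern x y - kern x x\<bar> \<le> \<bar>y - x\<bar> / root 3 m ^ 5"
proof -
  define a b \<alpha> where "a = root 3 x" and "b = root 3 y" and "\<alpha> = root 3 m"
  have o: "0 < \<alpha>" "\<alpha> \<le> a" "\<alpha> \<le> b" using m by (auto simp: a_def b_def \<alpha>_def)
  define K where "K = a\<^sup>2 + a * b + b\<^sup>2"
  have "\<alpha> * a \<le> a\<^sup>2" "\<alpha> * b \<le> b\<^sup>2" using o by (auto simp: power2_eq_square)
  moreover have "0 \<le> a * b" using o by simp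
  ultimately have K1: "\<alpha> * (a + b) \<le> K" by (simp add: K_def algebra_simps)
  have "\<alpha>\<^sup>2 \<le> a\<^sup>2" using o by (intro power_mono) auto
  then have K2: "\<alpha>\<^sup>2 \<le> K" using \<open>0 \<le> a * b\<close> by (simp add: K_def add_increasing2)
  have K0: "K > 0" using K2 o by (smt (verit) zero_less_power)
  have "y - x = b^3 - a^3" by (simp add: a_def b_def root3_cube)
  also have "\<dots> = (b - a) * K" unfolding K_def by algebra
  finally have "\<bar>y - x\<bar> = \<bar>b - a\<bar> * K" using K0 by (simp add: abs_mult)
  then have ba: "\<bar>b - a\<bar> * \<alpha>\<^sup>2 \<le> \<bar>y - x\<bar>" using K2 by (simp add: mult_left_mono)
  have "kern x y - kern x x = 1 / K - 1 / (3 * a\<^sup>2)"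
    by (simp add: kern_def a_def b_def K_def power2_eq_square)
  also have "\<dots> = (3 * a\<^sup>2 - K) / (K * (3 * a\<^sup>2))" using K0 o by (simp add: diff_divide_distrib)
  also have "3 * a\<^sup>2 - K = (a - b) * (b + 2 * a)" unfolding K_def by algebra
  finally have "\<bar>kern x y - kern x x\<bar> = \<bar>b - a\<bar> * ((b + 2 * a) / (K * (3 * a\<^sup>2)))"
    using K0 o by (simp add: abs_mult abs_minus_commute)
  \<comment> \<open>The bound \<open>\<alpha> * (a + b) \<le> K\<close> cancels the numerator and
    leaves \<open>1 / \<alpha>^3\<close>; passing from \<open>b - a\<close> to \<open>y - x\<close>
    costs another \<open>1 / \<alpha>^2\<close>.\<close>
  also have "\<dots> \<le> \<bar>b - a\<bar> * ((3 * (a + b)) / (\<alpha> * (a + b) * (3 * \<alpha>\<^sup>2)))"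
    using o K1 K0 \<open>\<alpha>\<^sup>2 \<le> a\<^sup>2\<close> by (intro mult_left_mono frac_le mult_mono mult_pos_pos) auto
  also have "\<dots> = \<bar>b - a\<bar> * \<alpha>\<^sup>2 / \<alpha>^5"
  proof -
    have "\<alpha> > 0" "a + b > 0" using o by auto
    then show ?thesis by (simp add: divide_simps) (simp add: eval_nat_numeral)
  qed
  also have "\<dots> \<le> \<bar>y - x\<bar> / \<alpha>^5" using ba o by (intro divide_right_mono) auto
  finally show ?thesis by (simp add: \<alpha>_def)
qed

context lsw_sol
begin

text \<open>The logarithmic growth rate of the gap differs from that of the linearized flow, which
  is the derivative of \<open>J\<close>, by at most a multiple of \<open>|y - x|\<close> uniformly
  on \<open>{0..t}\<close>. Integrating in time gives the bound.\<close>

lemma ln_gap_quotient_bound: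
  assumes t: "t \<ge> 0" and \<xi>: "chr x t \<xi>" and \<eta>: "chr y t \<eta>" and xy: "x \<noteq> y" "x > 0"
    and m: "m > 0" "\<And>s. s \<in> {0..t} \<Longrightarrow> m \<le> \<xi> s" "\<And>s. s \<in> {0..t} \<Longrightarrow> m \<le> \<eta> s"
    and M: "\<And>s. s \<in> {0..t} \<Longrightarrow> 1 / root 3 (L s) \<le> M"
    and J: "\<And>s. s \<in> {0..t} \<Longrightarrow> (J has_real_derivative kern (\<xi> s) (\<xi> s) / root 3 (L s)) (at s within {0..t})"
  shows "\<bar>ln \<bar>\<eta> 0 - \<xi> 0\<bar> - ln \<bar>y - x\<bar> + (J t - J 0)\<bar> \<le> \<bar>y - x\<bar> * (M / root 3 m ^ 5 * t)"
proof -
  define l where "l = (\<lambda>s. ln \<bar>\<eta> s - \<xi> s\<bar>)"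
  define B where "B = \<bar>y - x\<bar> * (M / root 3 m ^ 5)"
  have Lc: "continuous_on {0..t} L" by (rule continuous_on_subset[OF L_cont]) auto
  have cases: "(\<forall>s\<in>{0..t}. \<xi> s < \<eta> s) \<or> (\<forall>s\<in>{0..t}. \<eta> s < \<xi> s)"
    using chr_less_backward[OF \<xi> \<eta> _ _ Lc] chr_less_backward[OF \<eta> \<xi> _ _ Lc] xy by (cases "x < y") auto
  have dl: "(l has_real_derivative kern (\<xi> s) (\<eta> s) / root 3 (L s)) (at s within {0..t})" if s: "s \<in> {0..t}" for s
    using cases
  proof
    assume less: "\<forall>s\<in>{0..t}. \<xi> s < \<eta> s"
    have "ln (\<eta> u - \<xi> u) = l u" if "u \<in> {0..t}" for u
      using less that by (simp add: l_def abs_of_pos)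
    then show ?thesis
      using less s by (intro has_field_derivative_transform_within[OF ln_gap_deriv[OF \<xi> \<eta> s], of 1]) auto
  next
    assume less: "\<forall>s\<in>{0..t}. \<eta> s < \<xi> s"
    have "ln (\<xi> u - \<eta> u) = l u" if "u \<in> {0..t}" for u
      using less that by (simp add: l_def abs_of_neg)
    then show ?thesis unfolding kern_commute[of "\<xi> s" "\<eta> s"]
      using less s by (intro has_field_derivative_transform_within[OF ln_gap_deriv[OF \<eta> \<xi> s], of 1]) auto
  qed
  have bound: "\<bar>kern (\<xi> s) (\<eta> s) / root 3 (L s) - kern (\<xi> s) (\<xi> s) / root 3 (L s)\<bar> \<le> B" if s: "s \<in> {0..t}" for s
  proof -
    have Lp: "root 3 (L s) > 0" using L_pos[of s] s by simp
    have gap: "\<bar>\<eta> s - \<xi> s\<bar> \<le> \<bar>y - x\<bar>"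
      using chr_gap[OF \<xi> \<eta> _ s] chr_gap[OF \<eta> \<xi> _ s] by (cases "x \<le> y") auto
    have "\<bar>kern (\<xi> s) (\<eta> s) / root 3 (L s) - kern (\<xi> s) (\<xi> s) / root 3 (L s)\<bar>
        = \<bar>kern (\<xi> s) (\<eta> s) - kern (\<xi> s) (\<xi> s)\<bar> * (1 / root 3 (L s))"
      using Lp by (simp add: abs_divide flip: diff_divide_distrib)
    also have "\<dots> \<le> (\<bar>\<eta> s - \<xi> s\<bar> / root 3 m ^ 5) * M"
      using kern_diag_lipschitz[OF m(1) m(2)[OF s] m(3)[OF s]] M[OF s] Lp m(1) by (intro mult_mono) auto
    also have "\<dots> \<le> (\<bar>y - x\<bar> / root 3 m ^ 5) * M"
    proof (rule mult_right_mono)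
      have "0 < 1 / root 3 (L s)" using Lp by simp
      then show "0 \<le> M" using M[OF s] by linarith
    qed (use gap m in \<open>auto intro: divide_right_mono\<close>)
    finally show ?thesis by (simp add: B_def)
  qed
  have "(l 0 - J 0) + B * 0 \<le> (l t - J t) + B * t"
  proof (rule nondecreasing_if_deriv_nonneg[where S="{0..t}" and f="\<lambda>s. (l s - J s) + B * s"
        and f'="\<lambda>s. kern (\<xi> s) (\<eta> s) / root 3 (L s) - kern (\<xi> s) (\<xi> s) / root 3 (L s) + B"])
    fix s assume s: "s \<in> {0..t}"
    show "((\<lambda>s. (l s - J s) + B * s) has_real_derivative
        kern (\<xi> s) (\<eta> s) / root 3 (L s) - kern (\<xi> s) (\<xi> s) / root 3 (L s) + B) (at s within {0..t})"
      by (intro DERIV_add DERIV_diff dl[OF s] J[OF s]) (auto intro!: derivative_eq_intros)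
  next
    fix s assume "0 < s" "s < t"
    then show "0 \<le> kern (\<xi> s) (\<eta> s) / root 3 (L s) - kern (\<xi> s) (\<xi> s) / root 3 (L s) + B"
      using bound[of s] by auto
  qed (use t in auto)
  moreover have "- (l 0 - J 0) + B * 0 \<le> - (l t - J t) + B * t"
  proof (rule nondecreasing_if_deriv_nonneg[where S="{0..t}" and f="\<lambda>s. - (l s - J s) + B * s"
        and f'="\<lambda>s. - (kern (\<xi> s) (\<eta> s) / root 3 (L s) - kern (\<xi> s) (\<xi> s) / root 3 (L s)) + B"])
    fix s assume s: "s \<in> {0..t}"
    show "((\<lambda>s. - (l s - J s) + B * s) has_real_derivative
        - (kern (\<xi> s) (\<eta> s) / root 3 (L s) - kern (\<xi> s) (\<xi> s) / root 3 (L s)) + B) (at s within {0..t})"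
      by (intro DERIV_add DERIV_minus DERIV_diff dl[OF s] J[OF s]) (auto intro!: derivative_eq_intros)
  next
    fix s assume "0 < s" "s < t"
    then show "0 \<le> - (kern (\<xi> s) (\<eta> s) / root 3 (L s) - kern (\<xi> s) (\<xi> s) / root 3 (L s)) + B"
      using bound[of s] by auto
  qed (use t in auto)
  moreover have "l t = ln \<bar>y - x\<bar>" using characteristic_end[OF \<xi>] characteristic_end[OF \<eta>] by (simp add: l_def)
  ultimately show ?thesis unfolding l_def B_def by (simp add: abs_le_iff) 
qed

text \<open>For \<open>x > 0\<close> the characteristic stays in a compact subset of the positive
  half line, and \<open>ln_gap_quotient_bound\<close> makes the logarithm of the difference quotient
  converge to \<open>- (J t - J 0)\<close>.\<close>

lemma F_differentiable:
  assumes t: "t \<ge> 0" and x: "x > 0"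
  shows "(\<lambda>y. F y t) differentiable (at x)"
proof -
  define \<xi> where "\<xi> = chi x t"
  have \<xi>: "chr x t \<xi>" using chr_chi[OF t] x by (simp add: \<xi>_def)
  have Lc: "continuous_on {0..t} L" by (rule continuous_on_subset[OF L_cont]) auto
  have \<xi>c: "continuous_on {0..t} \<xi>" by (rule characteristic_continuous[OF \<xi>])
  have \<xi>p: "\<xi> s > 0" if "s \<in> {0..t}" for s using chr_pos'[OF \<xi> _ _ x] that by auto
  have Lp: "L s > 0" if "s \<in> {0..t}" for s using L_pos that by auto
  have "\<exists>s\<in>{0..t}. \<forall>u\<in>{0..t}. \<xi> s \<le> \<xi> u" using \<xi>c t by (intro continuous_attains_inf) auto
  then obtain s0 where s0: "s0 \<in> {0..t}" "\<And>u. u \<in> {0..t} \<Longrightarrow> \<xi> s0 \<le> \<xi> u" by blast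
  have "\<exists>s\<in>{0..t}. \<forall>u\<in>{0..t}. L s \<le> L u" using Lc t by (intro continuous_attains_inf) auto
  then obtain s1 where s1: "s1 \<in> {0..t}" "\<And>u. u \<in> {0..t} \<Longrightarrow> L s1 \<le> L u" by blast
  \<comment> \<open>Half of the minimum of \<xi>: gaps are at most \<open>|y - x| < m\<close>, so
    neighbouring characteristics stay above \<open>m\<close>.\<close>
  define m where "m = \<xi> s0 / 2"
  have m: "m > 0" using \<xi>p[OF s0(1)] by (simp add: m_def)
  define M where "M = 1 / root 3 (L s1)"
  have M: "1 / root 3 (L s) \<le> M" if "s \<in> {0..t}" for s
    unfolding M_def using Lp[OF s1(1)] Lp[OF that] s1(2)[OF that] by (intro divide_left_mono) auto
  define k where "k = (\<lambda>s. kern (\<xi> s) (\<xi> s) / root 3 (L s))"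
  have kc: "continuous_on {0..t} k"
    unfolding k_def kern_def using \<xi>p Lp
    by (intro continuous_intros \<xi>c Lc) (fastforce simp: power2_eq_square)+
  define J where "J = (\<lambda>s. integral {0..s} k)"
  have J: "(J has_real_derivative kern (\<xi> s) (\<xi> s) / root 3 (L s)) (at s within {0..t})" if "s \<in> {0..t}" for s
    using integral_has_real_derivative[OF kc that] unfolding J_def k_def .
  define C where "C = M / root 3 m ^ 5 * t"
  define q where "q = (\<lambda>y. (F y t - F x t) / (y - x))"
  have q: "q y > 0 \<and> \<bar>ln (q y) + (J t - J 0)\<bar> \<le> \<bar>y - x\<bar> * C" if y: "\<bar>y - x\<bar> < min m x" "y \<noteq> x" for y
  proof -
    have y0: "y > 0" using y by auto
    have \<eta>: "chr y t (chi y t)" using chr_chi[OF t] y0 by simp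
    have "m \<le> chi y t s" if s: "s \<in> {0..t}" for s
      using chr_gap[OF \<xi> \<eta> _ s] chr_gap[OF \<eta> \<xi> _ s] s0(2)[OF s] y m by (cases "x \<le> y") (auto simp: m_def)
    moreover have "m \<le> \<xi> s" if s: "s \<in> {0..t}" for s using s0(2)[OF s] m by (simp add: m_def)
    ultimately have "\<bar>ln \<bar>chi y t 0 - \<xi> 0\<bar> - ln \<bar>y - x\<bar> + (J t - J 0)\<bar> \<le> \<bar>y - x\<bar> * C"
      unfolding C_def using y x m M J by (intro ln_gap_quotient_bound[OF t \<xi> \<eta>]) auto
    moreover have "q y > 0"
      using F_strict_mono[OF t, of x y] F_strict_mono[OF t, of y x] x y0 y(2)
      by (cases "x < y") (auto simp: q_def zero_less_divide_iff)
    moreover have "q y = \<bar>chi y t 0 - \<xi> 0\<bar> / \<bar>y - x\<bar>"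
      using \<open>q y > 0\<close> by (simp add: q_def F_def \<xi>_def flip: abs_divide)
    moreover have "\<bar>chi y t 0 - \<xi> 0\<bar> \<noteq> 0" using calculation by auto
    ultimately show ?thesis using y(2) by (simp add: ln_div)
  qed
  have ev: "eventually (\<lambda>y. q y > 0 \<and> \<bar>ln (q y) + (J t - J 0)\<bar> \<le> \<bar>y - x\<bar> * C) (at x)"
    unfolding eventually_at using q m x by (intro exI[of _ "min m x"]) (auto simp: dist_real_def)
  have "((\<lambda>y. ln (q y) + (J t - J 0)) \<longlongrightarrow> 0) (at x)"
  proof (rule Lim_null_comparison)
    show "\<forall>\<^sub>F y in at x. norm (ln (q y) + (J t - J 0)) \<le> \<bar>y - x\<bar> * C"
      using ev by (rule eventually_mono) simp
    show "((\<lambda>y. \<bar>y - x\<bar> * C) \<longlongrightarrow> 0) (at x)"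
      by (auto intro!: tendsto_eq_intros)
  qed
  from tendsto_diff[OF this tendsto_const[of "J t - J 0"]]
  have "((\<lambda>y. ln (q y)) \<longlongrightarrow> - (J t - J 0)) (at x)" by simp
  from tendsto_exp[OF this] have "((\<lambda>y. exp (ln (q y))) \<longlongrightarrow> exp (- (J t - J 0))) (at x)" .
  then have "(q \<longlongrightarrow> exp (- (J t - J 0))) (at x)"
    by (rule Lim_transform_eventually) (rule eventually_mono[OF ev], simp)
  then have "((\<lambda>y. F y t) has_real_derivative exp (- (J t - J 0))) (at x)"
    by (simp add: q_def has_field_derivative_iff)
  then show ?thesis using real_differentiable_def by blast
qed

text \<open>The density integrates to \<open>w 0 t\<close> and has first moment 1. The point
  \<open>c\<close> has at most one preimage under the strictly increasing \<open>F\<close>, so the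
  exceptional set is finite.\<close>

lemma mean_volume_eq:
  assumes t: "t \<ge> 0" and cont: "continuous_on {0..} w0"
    and diff: "\<And>z. z > 0 \<Longrightarrow> z \<noteq> c \<Longrightarrow> w0 differentiable (at z)"
  shows "mean_volume w t = 1 / w 0 t"
proof -
  define v where "v = (\<lambda>y. w y t)"
  have v: "v y = w0 (F y t)" if "y \<ge> 0" for y using w_eq[OF t that] by (simp add: v_def)
  define E where "E = {x. x > 0 \<and> F x t = c}"
  have "finite E"
  proof (cases "\<exists>x. x \<in> E")
    case True
    then obtain x where x: "x \<in> E" by blast
    have "E \<subseteq> {x}"
      using F_strict_mono[OF t] x by (auto simp: E_def) (metis less_irrefl linorder_neqE_linordered_idom less_imp_le)
    then show ?thesis using finite_subset by blast
  next
    case False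
    then have "E = {}" by blast
    then show ?thesis by simp
  qed
  have "continuous_on {0..} (\<lambda>y. w0 (F y t))"
    by (rule continuous_on_compose2[OF cont F_continuous[OF t]]) (use F_nonneg[OF t] in auto)
  then have vc: "continuous_on {0..} v" by (rule continuous_on_eq) (simp add: v)
  have vd: "v differentiable (at x)" if x: "x > 0" "x \<notin> E" for x
  proof -
    have "F x t > 0" using F_strict_mono[OF t, of 0 x] F_nonneg[OF t, of 0] x by simp
    moreover have "F x t \<noteq> c" using x by (simp add: E_def)
    ultimately obtain D1 where D1: "(w0 has_real_derivative D1) (at (F x t))"
      using diff real_differentiable_def by blast
    obtain D2 where D2: "((\<lambda>y. F y t) has_real_derivative D2) (at x)"
      using F_differentiable[OF t x(1)] real_differentiable_def by blast
    have "((\<lambda>y. w0 (F y t)) has_real_derivative D1 * D2) (at x)"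
      by (rule DERIV_chain2[OF D1 D2])
    then have "(v has_real_derivative D1 * D2) (at x)"
      by (rule has_field_derivative_transform_within_open[of _ _ _ "{0<..}"]) (use x v in auto)
    then show ?thesis using real_differentiable_def by blast
  qed
  have cd: "cluster_density w x t = - deriv v x" for x
    by (simp add: cluster_density_def v_def)
  have "(LBINT x:{0<..}. - deriv v x) = v 0" "(LBINT x:{0<..}. x * - deriv v x) = (LBINT x:{0..}. v x)"
    using antimono_density_integrals[OF vc _ _ _ \<open>finite E\<close> vd] w_antimono[OF t] w_nonneg[OF t] w_integrable[OF t]
    unfolding v_def by blast+
  then show ?thesis
    using w_integral[OF t] unfolding mean_volume_def cd by (simp add: v_def)
qed

end

section \<open>Initial data with a beta function\<close>

locale beta_data =
  fixes w0 :: "real \<Rightarrow> real" and \<mu> :: "real measure" and b :: ereal and \<beta> :: "real \<Rightarrow> real"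
  assumes init: "lsw_initial_data w0" and law: "associated_law w0 \<mu>"
    and b: "sup_norm \<mu> = b" and beta: "is_beta_function w0 b \<beta>"
begin

lemma w0_nonneg: "x \<ge> 0 \<Longrightarrow> w0 x \<ge> 0"
  using init unfolding lsw_initial_data_def by auto

lemma w0_antimono: "0 \<le> u \<Longrightarrow> u \<le> v \<Longrightarrow> w0 v \<le> w0 u"
  using init unfolding lsw_initial_data_def monotone_on_def by auto

lemma tail_0: "tail_int w0 0 = 1"
  using init by (simp add: lsw_initial_data_def tail_int_def)

lemma w0_0_pos: "w0 0 > 0"
proof (rule ccontr)
  assume "\<not> w0 0 > 0"
  then have "w0 x = 0" if "x \<ge> 0" for x using w0_antimono[of 0 x] w0_nonneg[of x] that by auto
  then have "(LBINT x:{0..}. w0 x) = 0"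
    unfolding set_lebesgue_integral_def by (intro integral_eq_zero_AE) (auto simp: indicator_def)
  then show False using tail_0 by (simp add: tail_int_def)
qed

lemma w0_pos_iff:
  assumes "x \<ge> 0"
  shows "w0 x > 0 \<longleftrightarrow> ereal x < b"
proof -
  interpret real_distribution \<mu> using law by (simp add: associated_law_def)
  have m: "measure \<mu> {x<..} = w0 x / w0 0" using law assms by (simp add: associated_law_def)
  have meas: "ereal \<in> borel_measurable \<mu>" by simp
  have eb: "esssup \<mu> ereal = b" using b by (simp add: sup_norm_def)
  show ?thesis
  proof
    assume "ereal x < b"
    then have "emeasure \<mu> {y \<in> space \<mu>. ereal y > ereal x} > 0"
      using esssup_pos_measure[OF meas, of "ereal x"] eb by simp
    also have "{y \<in> space \<mu>. ereal y > ereal x} = {x<..}" by auto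
    finally have "measure \<mu> {x<..} > 0" by (simp add: emeasure_eq_measure)
    then show "w0 x > 0" using m w0_0_pos by (simp add: zero_less_divide_iff)
  next
    assume pos: "w0 x > 0"
    show "ereal x < b"
    proof (rule ccontr)
      assume "\<not> ereal x < b"
      then have "{x<..} \<subseteq> {y \<in> space \<mu>. ereal y > esssup \<mu> ereal}"
        unfolding eb by (auto simp: not_less intro: le_less_trans)
      then have "emeasure \<mu> {x<..} \<le> 0"
        using esssup_zero_measure[of \<mu> ereal] emeasure_mono[of "{x<..}" "{y \<in> space \<mu>. ereal y > esssup \<mu> ereal}" \<mu>]
        by simp
      then have "measure \<mu> {x<..} = 0" by (simp add: emeasure_eq_measure)
      then show False using m pos w0_0_pos by simp
    qed
  qed
qed

lemma w0_pos: "x \<in> beta_dom b \<Longrightarrow> w0 x > 0"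
  using w0_pos_iff by (simp add: beta_dom_def)

lemma w0_zero: "x \<ge> 0 \<Longrightarrow> x \<notin> beta_dom b \<Longrightarrow> w0 x = 0"
  using w0_pos_iff[of x] w0_nonneg[of x] by (auto simp: beta_dom_def)

lemma zero_in_dom: "0 \<in> beta_dom b"
  using w0_pos_iff[of 0] w0_0_pos by (simp add: beta_dom_def)

lemma dom_nonneg: "x \<in> beta_dom b \<Longrightarrow> 0 \<le> x"
  by (simp add: beta_dom_def)

lemma dom_below: "y \<in> beta_dom b \<Longrightarrow> 0 \<le> x \<Longrightarrow> x \<le> y \<Longrightarrow> x \<in> beta_dom b"
  by (auto simp: beta_dom_def intro: le_less_trans[of "ereal x" "ereal y"])

lemma dom_Icc: "y \<in> beta_dom b \<Longrightarrow> 0 \<le> x \<Longrightarrow> {x..y} \<subseteq> beta_dom b"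
  using dom_below by auto

lemma dom_above:
  assumes "x \<in> beta_dom b"
  obtains y where "x < y" "y \<in> beta_dom b"
proof -
  have "ereal x < b" "0 \<le> x" using assms by (auto simp: beta_dom_def)
  from ereal_dense2[OF this(1)] obtain y where "ereal x < ereal y" "ereal y < b" by auto
  then show ?thesis using that[of y] \<open>0 \<le> x\<close> by (auto simp: beta_dom_def)
qed

lemma tail_pos: "x \<in> beta_dom b \<Longrightarrow> tail_int w0 x > 0"
proof -
  assume x: "x \<in> beta_dom b"
  then obtain y where y: "x < y" "y \<in> beta_dom b" by (rule dom_above)
  have "0 < (y - x) * w0 y" using y w0_pos by simp
  also have "\<dots> \<le> tail_int w0 x - tail_int w0 y"
    using tail_int_antimono_bounds(4)[OF init dom_nonneg[OF x], of y] y by simp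
  also have "\<dots> \<le> tail_int w0 x"
    using tail_int_antimono_bounds(2)[OF init dom_nonneg[OF y(2)] order_refl] by simp
  finally show ?thesis .
qed

section \<open>Derivatives of the tail integral and of \<open>w0\<close>\<close>

lemma w0_right_continuous:
  assumes "x \<ge> 0"
  shows "(w0 \<longlongrightarrow> w0 x) (at_right x)"
proof -
  interpret real_distribution \<mu> using law by (simp add: associated_law_def)
  have eq: "w0 y = w0 0 * (1 - cdf \<mu> y)" if "y \<ge> 0" for y
  proof -
    have "{y<..} = space \<mu> - {..y}" by auto
    then have "measure \<mu> {y<..} = 1 - cdf \<mu> y"
      using prob_compl[of "{..y}"] unfolding cdf_def by simp
    moreover have "w0 y = w0 0 * measure \<mu> {y<..}" using law that w0_0_pos by (simp add: associated_law_def)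
    ultimately show ?thesis by simp
  qed
  have "(cdf \<mu> \<longlongrightarrow> cdf \<mu> x) (at_right x)"
    using cdf_is_right_cont[of x] by (simp add: continuous_within)
  then have "((\<lambda>y. w0 0 * (1 - cdf \<mu> y)) \<longlongrightarrow> w0 0 * (1 - cdf \<mu> x)) (at_right x)"
    by (intro tendsto_intros)
  moreover have "eventually (\<lambda>y. w0 0 * (1 - cdf \<mu> y) = w0 y) (at_right x)"
    by (rule eventually_at_rightI[of x "x + 1"]) (use assms in \<open>simp_all add: eq[symmetric]\<close>)
  ultimately show ?thesis
    unfolding eq[OF assms, symmetric] by (rule Lim_transform_eventually)
qed

text \<open>The right difference quotient at \<open>x\<close> lies between \<open>- w0 x\<close> and
  \<open>- w0 u\<close>, and \<open>w0\<close> is right-continuous. This identifies the first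
  derivative in the definition of the beta function.\<close>

lemma tail_derivative_unique:
  assumes x: "x \<in> beta_dom b" and d: "(tail_int w0 has_real_derivative D) (at x within beta_dom b)"
  shows "D = - w0 x"
proof -
  obtain y where y: "x < y" "y \<in> beta_dom b" using x by (rule dom_above)
  have x0: "0 \<le> x" using dom_nonneg[OF x] .
  have "(tail_int w0 has_real_derivative D) (at x within {x..y})"
    using d dom_Icc[OF y(2) x0] by (rule has_field_derivative_subset)
  then have "(tail_int w0 has_real_derivative D) (at_right x)" using y by (simp add: at_within_Icc_at_right)
  then have lim: "((\<lambda>u. (tail_int w0 u - tail_int w0 x) / (u - x)) \<longlongrightarrow> D) (at_right x)"
    by (simp add: has_field_derivative_iff)
  have "((\<lambda>u. (tail_int w0 u - tail_int w0 x) / (u - x)) \<longlongrightarrow> - w0 x) (at_right x)"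
  proof (rule tendsto_sandwich)
    show "eventually (\<lambda>u. - w0 x \<le> (tail_int w0 u - tail_int w0 x) / (u - x)) (at_right x)"
    proof (rule eventually_at_rightI[of x "x + 1"])
      fix u assume "u \<in> {x<..<x+1}"
      then show "- w0 x \<le> (tail_int w0 u - tail_int w0 x) / (u - x)"
        using tail_int_antimono_bounds(3)[OF init x0, of u] by (simp add: field_simps)
    qed simp
    show "eventually (\<lambda>u. (tail_int w0 u - tail_int w0 x) / (u - x) \<le> - w0 u) (at_right x)"
    proof (rule eventually_at_rightI[of x "x + 1"])
      fix u assume "u \<in> {x<..<x+1}"
      then show "(tail_int w0 u - tail_int w0 x) / (u - x) \<le> - w0 u"
        using tail_int_antimono_bounds(4)[OF init x0, of u] by (simp add: field_simps)
    qed simp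
    show "((\<lambda>u. - w0 u) \<longlongrightarrow> - w0 x) (at_right x)"
      by (intro tendsto_minus w0_right_continuous x0)
  qed simp
  then show ?thesis using tendsto_unique[OF _ lim] by simp
qed

lemma tail_deriv: "x \<in> beta_dom b \<Longrightarrow> (tail_int w0 has_real_derivative - w0 x) (at x within beta_dom b)"
  using beta tail_derivative_unique unfolding is_beta_function_def by metis

text \<open>With \<open>h' = - w0\<close> the formula for \<beta> can be solved for
  \<open>h''\<close>, which is minus the derivative of \<open>w0\<close>.\<close>

lemma w0_deriv:
  assumes x: "x \<in> beta_dom b"
  shows "(w0 has_real_derivative - (\<beta> x * (w0 x)\<^sup>2 / tail_int w0 x)) (at x within beta_dom b)"
proof -
  obtain h' h'' where h: "\<And>x. x \<in> beta_dom b \<Longrightarrow> (tail_int w0 has_real_derivative h' x) (at x within beta_dom b)"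
    "\<And>x. x \<in> beta_dom b \<Longrightarrow> (h' has_real_derivative h'' x) (at x within beta_dom b)"
    "\<And>x. x \<in> beta_dom b \<Longrightarrow> \<beta> x = h'' x * tail_int w0 x / (h' x)\<^sup>2"
    using beta unfolding is_beta_function_def by blast
  have h': "h' u = - w0 u" if "u \<in> beta_dom b" for u
    using tail_derivative_unique[OF that h(1)[OF that]] .
  have "h'' x = \<beta> x * (w0 x)\<^sup>2 / tail_int w0 x"
    using h(3)[OF x] h'[OF x] w0_pos[OF x] tail_pos[OF x] by (simp add: field_simps)
  moreover have "(w0 has_real_derivative - h'' x) (at x within beta_dom b)"
    using h' x by (intro has_field_derivative_transform_within[OF DERIV_minus[OF h(2)[OF x]], of 1]) auto
  ultimately show ?thesis by simp
qed

text \<open>The quotient is the mean residual life, the conditional expectation of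
  \<open>X - x\<close> given \<open>X > x\<close>. Its derivative depends on \<beta> alone.\<close>

lemma mean_residual_deriv:
  assumes x: "x \<in> beta_dom b"
  shows "((\<lambda>x. tail_int w0 x / w0 x) has_real_derivative \<beta> x - 1) (at x within beta_dom b)"
proof -
  have "((\<lambda>x. tail_int w0 x / w0 x) has_real_derivative
      (- w0 x * w0 x - tail_int w0 x * - (\<beta> x * (w0 x)\<^sup>2 / tail_int w0 x)) / (w0 x * w0 x)) (at x within beta_dom b)"
    using w0_pos[OF x] by (intro DERIV_divide tail_deriv w0_deriv x) auto
  also have "(- w0 x * w0 x - tail_int w0 x * - (\<beta> x * (w0 x)\<^sup>2 / tail_int w0 x)) / (w0 x * w0 x) = \<beta> x - 1"
    using w0_pos[OF x] tail_pos[OF x] by (simp add: field_simps power2_eq_square)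
  finally show ?thesis .
qed

section \<open>Power laws between \<open>w0\<close> and its tail integral\<close>

lemma ln_w0_deriv:
  assumes x: "x \<in> beta_dom b"
  shows "((\<lambda>x. ln (w0 x)) has_real_derivative - (\<beta> x * (w0 x / tail_int w0 x))) (at x within beta_dom b)"
proof -
  have "1 / w0 x * - (\<beta> x * (w0 x)\<^sup>2 / tail_int w0 x) = - (\<beta> x * (w0 x / tail_int w0 x))"
    using w0_pos[OF x] by (simp add: power2_eq_square)
  then show ?thesis using DERIV_chain2[OF DERIV_ln_divide w0_deriv[OF x]] w0_pos[OF x] by simp
qed

lemma ln_tail_deriv:
  assumes x: "x \<in> beta_dom b"
  shows "((\<lambda>x. ln (tail_int w0 x)) has_real_derivative - (w0 x / tail_int w0 x)) (at x within beta_dom b)"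
  using DERIV_chain2[OF DERIV_ln_divide tail_deriv[OF x]] tail_pos[OF x] by simp

text \<open>With \<open>h\<close> the tail integral, \<open>(ln w0)' = \<beta> * (ln h)'\<close> and
  \<open>(ln h)' < 0\<close>, so \<open>\<beta> \<le> B\<close> makes
  \<open>ln w0 - B * ln h\<close> nondecreasing. A lower bound for \<beta> acts in the opposite
  direction.\<close>

lemma w0_ge_tail_powr:
  assumes "0 \<le> x" "x \<le> y" "y \<in> beta_dom b" and B: "\<And>u. u \<in> {x..y} \<Longrightarrow> \<beta> u \<le> B"
  shows "(tail_int w0 y / tail_int w0 x) powr B \<le> w0 y / w0 x"
proof -
  have sub: "{x..y} \<subseteq> beta_dom b" using dom_Icc[OF assms(3,1)] .
  have "ln (w0 x) - B * ln (tail_int w0 x) \<le> ln (w0 y) - B * ln (tail_int w0 y)"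
  proof (rule nondecreasing_if_deriv_nonneg[OF assms(2) sub, where f="\<lambda>u. ln (w0 u) - B * ln (tail_int w0 u)"
        and f'="\<lambda>u. - (\<beta> u * (w0 u / tail_int w0 u)) - B * - (w0 u / tail_int w0 u)"])
    fix u assume "u \<in> {x..y}"
    then show "((\<lambda>u. ln (w0 u) - B * ln (tail_int w0 u)) has_real_derivative
        - (\<beta> u * (w0 u / tail_int w0 u)) - B * - (w0 u / tail_int w0 u)) (at u within beta_dom b)"
      using sub by (intro DERIV_diff DERIV_cmult ln_w0_deriv ln_tail_deriv) auto
  next
    fix u assume u: "x < u" "u < y"
    then have "u \<in> beta_dom b" using sub by auto
    then have "0 \<le> (B - \<beta> u) * (w0 u / tail_int w0 u)"
      using B[of u] u w0_pos[of u] tail_pos[of u] by (intro mult_nonneg_nonneg) auto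
    then show "0 \<le> - (\<beta> u * (w0 u / tail_int w0 u)) - B * - (w0 u / tail_int w0 u)"
      by (simp add: left_diff_distrib diff_divide_distrib)
  qed
  then have "B * ln (tail_int w0 y / tail_int w0 x) \<le> ln (w0 y / w0 x)"
    using sub assms(2) by (simp add: ln_div w0_pos tail_pos less_imp_neq[THEN not_sym] right_diff_distrib subset_iff)
  moreover have "x \<in> beta_dom b" "y \<in> beta_dom b" using sub assms(2) by auto
  ultimately show ?thesis
    using w0_pos[of x] w0_pos[of y] tail_pos[of x] tail_pos[of y]
    by (simp add: powr_def ln_ge_iff)
qed

lemma w0_le_tail_powr:
  assumes "0 \<le> x" "x \<le> y" "y \<in> beta_dom b" and B: "\<And>u. u \<in> {x..y} \<Longrightarrow> a \<le> \<beta> u"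
  shows "w0 y / w0 x \<le> (tail_int w0 y / tail_int w0 x) powr a"
proof -
  have sub: "{x..y} \<subseteq> beta_dom b" using dom_Icc[OF assms(3,1)] .
  have "a * ln (tail_int w0 x) - ln (w0 x) \<le> a * ln (tail_int w0 y) - ln (w0 y)"
  proof (rule nondecreasing_if_deriv_nonneg[OF assms(2) sub, where f="\<lambda>u. a * ln (tail_int w0 u) - ln (w0 u)"
        and f'="\<lambda>u. a * - (w0 u / tail_int w0 u) - - (\<beta> u * (w0 u / tail_int w0 u))"])
    fix u assume "u \<in> {x..y}"
    then show "((\<lambda>u. a * ln (tail_int w0 u) - ln (w0 u)) has_real_derivative
        a * - (w0 u / tail_int w0 u) - - (\<beta> u * (w0 u / tail_int w0 u))) (at u within beta_dom b)"
      using sub by (intro DERIV_diff DERIV_cmult ln_w0_deriv ln_tail_deriv) auto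
  next
    fix u assume u: "x < u" "u < y"
    then have "u \<in> beta_dom b" using sub by auto
    then have "0 \<le> (\<beta> u - a) * (w0 u / tail_int w0 u)"
      using B[of u] u w0_pos[of u] tail_pos[of u] by (intro mult_nonneg_nonneg) auto
    then show "0 \<le> a * - (w0 u / tail_int w0 u) - - (\<beta> u * (w0 u / tail_int w0 u))"
      by (simp add: left_diff_distrib diff_divide_distrib)
  qed
  then have "ln (w0 y / w0 x) \<le> a * ln (tail_int w0 y / tail_int w0 x)"
    using sub assms(2) by (simp add: ln_div w0_pos tail_pos less_imp_neq[THEN not_sym] right_diff_distrib subset_iff)
  then have "exp (ln (w0 y / w0 x)) \<le> exp (a * ln (tail_int w0 y / tail_int w0 x))" by simp
  moreover have "x \<in> beta_dom b" "y \<in> beta_dom b" using sub assms(2) by auto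
  ultimately show ?thesis
    using w0_pos[of x] w0_pos[of y] tail_pos[of x] tail_pos[of y]
    by (simp add: powr_def)
qed

text \<open>The rectangle of height \<open>w0 z\<close> over the step takes half of the tail
  integral, so at least half of the tail remains. The power law with exponent \<open>B\<close> then
  bounds the drop of \<open>w0\<close> by the factor \<open>\<kappa> = 2 powr (- B)\<close>. Hence
  at least the fraction \<open>\<kappa> / 2\<close> of the tail is removed, and the power law with
  exponent \<open>a\<close> turns this into a definite drop of \<open>w0\<close>.\<close>

lemma half_step:
  assumes z: "z \<in> beta_dom b" and B: "\<And>u. u \<in> beta_dom b \<Longrightarrow> \<beta> u \<le> B" "B \<ge> 0"
    and a: "\<And>u. u \<in> beta_dom b \<Longrightarrow> u \<ge> z \<Longrightarrow> a \<le> \<beta> u" "a > 0"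
    and z'_def: "z' = z + tail_int w0 z / (2 * w0 z)"
  shows "z' \<in> beta_dom b" "z < z'" "2 powr (- B) * w0 z \<le> w0 z'"
    "w0 z' \<le> (1 - 2 powr (- B) / 2) powr a * w0 z"
proof -
  define \<kappa> where "\<kappa> = 2 powr (- B)"
  have \<kappa>: "0 < \<kappa>" "\<kappa> \<le> 1"
    using B(2) powr_mono[of "- B" 0 "2::real"] by (auto simp: \<kappa>_def)
  have z0: "0 \<le> z" using dom_nonneg[OF z] .
  note p = w0_pos[OF z] tail_pos[OF z]
  show less: "z < z'" using p by (simp add: z'_def)
  have z'0: "0 \<le> z'" using less z0 by simp
  have d: "(z' - z) * w0 z = tail_int w0 z / 2" using p by (simp add: z'_def)
  have half: "tail_int w0 z / 2 \<le> tail_int w0 z'"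
    using tail_int_antimono_bounds(3)[OF init z0, of z'] less d by simp
  show z': "z' \<in> beta_dom b"
  proof (rule ccontr)
    assume out: "z' \<notin> beta_dom b"
    have "w0 u = 0" if "u \<ge> z'" for u
      using out that z'0 dom_below[of u z'] by (intro w0_zero) auto
    then have "tail_int w0 z' = 0"
      unfolding tail_int_def set_lebesgue_integral_def by (intro integral_eq_zero_AE) (auto simp: indicator_def)
    then show False using half p by simp
  qed
  have sub: "{z..z'} \<subseteq> beta_dom b" using dom_Icc[OF z' z0] .
  have p': "w0 z' > 0" "tail_int w0 z' > 0" using w0_pos[OF z'] tail_pos[OF z'] by auto
  have "\<kappa> = (1 / 2) powr B" by (simp add: \<kappa>_def powr_minus_divide powr_divide)
  also have "\<dots> \<le> (tail_int w0 z' / tail_int w0 z) powr B"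
    using half p B(2) by (intro powr_mono2) (auto simp: field_simps)
  also have "\<dots> \<le> w0 z' / w0 z" using sub less B by (intro w0_ge_tail_powr[OF z0 _ z']) auto
  finally have k: "\<kappa> * w0 z \<le> w0 z'" using p by (simp add: field_simps)
  then show "2 powr (- B) * w0 z \<le> w0 z'" by (simp add: \<kappa>_def)
  have "\<kappa> * (tail_int w0 z / 2) = (z' - z) * (\<kappa> * w0 z)" unfolding d[symmetric] by simp
  also have "\<dots> \<le> (z' - z) * w0 z'" using k less by (intro mult_left_mono) auto
  also have "\<dots> \<le> tail_int w0 z - tail_int w0 z'"
    using tail_int_antimono_bounds(4)[OF init z0, of z'] less by simp
  finally have "tail_int w0 z' / tail_int w0 z \<le> 1 - \<kappa> / 2" using p by (simp add: field_simps)
  then have "(tail_int w0 z' / tail_int w0 z) powr a \<le> (1 - \<kappa> / 2) powr a"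
    using p p' a(2) by (intro powr_mono2) auto
  moreover have "w0 z' / w0 z \<le> (tail_int w0 z' / tail_int w0 z) powr a"
    using sub less a(1) by (intro w0_le_tail_powr[OF z0 _ z']) auto
  ultimately have "w0 z' / w0 z \<le> (1 - \<kappa> / 2) powr a" by linarith
  then show "w0 z' \<le> (1 - 2 powr (- B) / 2) powr a * w0 z" using p by (simp add: \<kappa>_def field_simps)
qed

text \<open>Only a finite end point is excluded, since \<open>real_of_ereal b\<close> is 0 for
  infinite \<open>b\<close>. Beyond the end point \<open>w0\<close> vanishes identically.\<close>

lemma w0_differentiable:
  assumes z: "z > 0" "z \<noteq> real_of_ereal b"
  shows "w0 differentiable (at z)"
proof (cases "z \<in> beta_dom b")
  case True
  then obtain y where y: "z < y" "y \<in> beta_dom b" by (rule dom_above)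
  have "(w0 has_real_derivative - (\<beta> z * (w0 z)\<^sup>2 / tail_int w0 z)) (at z within {0..y})"
    using w0_deriv[OF True] dom_Icc[OF y(2)] by (rule has_field_derivative_subset) simp
  then have "(w0 has_real_derivative - (\<beta> z * (w0 z)\<^sup>2 / tail_int w0 z)) (at z)"
    using y z by (simp add: at_within_Icc_at)
  then show ?thesis using real_differentiable_def by blast
next
  case False
  then have "b \<le> ereal z" using z by (auto simp: beta_dom_def)
  moreover have "0 < b" using zero_in_dom by (simp add: beta_dom_def zero_ereal_def)
  ultimately obtain c where c: "b = ereal c" "0 < c" "c < z"
    using z(2) by (cases b) auto
  have "w0 u = 0" if "u > c" for u using that c by (intro w0_zero) (auto simp: beta_dom_def)
  then have "(w0 has_real_derivative 0) (at z)"
    using c by (intro has_field_derivative_transform_within_open[OF DERIV_const, of "{c<..}"]) auto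
  then show ?thesis using real_differentiable_def by blast
qed

text \<open>Below the end point continuity follows from differentiability; at the end point
  \<open>small\<close> rules out a jump to 0.\<close>

lemma w0_continuous:
  assumes small: "\<And>e. e > 0 \<Longrightarrow> \<exists>u\<in>beta_dom b. w0 u < e"
  shows "continuous_on {0..} w0"
  unfolding continuous_on_eq_continuous_within
proof
  fix x :: real assume x: "x \<in> {0..}"
  show "continuous (at x within {0..}) w0"
  proof (cases "x \<in> beta_dom b")
    case True
    then obtain y where y: "x < y" "y \<in> beta_dom b" by (rule dom_above)
    have "continuous (at x within {0..y}) w0"
      using DERIV_continuous[OF has_field_derivative_subset[OF w0_deriv[OF True] dom_Icc[OF y(2)]]] by simp
    moreover have "at x within {0..} = at x within {0..y}"
      using y by (intro at_within_nhd[of x "{..<y}"]) auto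
    ultimately show ?thesis by simp
  next
    case False
    have 0: "w0 x = 0" using w0_zero x False by simp
    show ?thesis
      unfolding continuous_within_eps_delta
    proof (intro allI impI)
      fix e :: real assume "e > 0"
      then obtain u where u: "u \<in> beta_dom b" "w0 u < e" using small by blast
      have "u < x" using dom_below[OF u(1), of x] False x by (meson atLeast_iff not_le)
      show "\<exists>d>0. \<forall>x'\<in>{0..}. dist x' x < d \<longrightarrow> dist (w0 x') (w0 x) < e"
      proof (intro exI[of _ "x - u"] conjI ballI impI)
        fix v assume v: "v \<in> {0..}" "dist v x < x - u"
        then have "u \<le> v" by (simp add: dist_real_def abs_less_iff)
        then show "dist (w0 v) (w0 x) < e"
          using w0_antimono[of u v] dom_nonneg[OF u(1)] u(2) w0_nonneg[of v] v 0 by (simp add: dist_real_def)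
      qed (use \<open>u < x\<close> in simp)
    qed
  qed
qed

end

text \<open>With \<open>\<beta>\<close> and \<open>b\<close> prescribed, \<open>h/w\<close> is known up to an additive constant. A larger constant
  gives a larger law, and \<open>L 0 = 1\<close> fixes the moment of order 1/3. Hence \<open>w\<^sub>0\<close> is determined, and
  the constant of the theorem may be read off from \<open>w\<^sub>0\<close>.\<close>

locale beta_data_pair = D1: beta_data w1 \<mu>1 b \<beta> + D2: beta_data w2 \<mu>2 b \<beta> for w1 \<mu>1 w2 \<mu>2 b \<beta>
begin

text \<open>The logarithmic derivative of \<open>w\<close> is \<open>- \<beta>\<close> divided by
  the mean residual life, so a larger mean residual life means slower decay.\<close>

lemma tails_ordered:
  assumes m: "\<And>u. u \<in> beta_dom b \<Longrightarrow> tail_int w2 u / w2 u \<le> tail_int w1 u / w1 u"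
    and \<beta>: "\<And>u. u \<in> beta_dom b \<Longrightarrow> 0 \<le> \<beta> u" and x: "x \<ge> 0"
  shows "w2 x / w2 0 \<le> w1 x / w1 0"
proof (cases "x \<in> beta_dom b")
  case True
  have sub: "{0..x} \<subseteq> beta_dom b" using D1.dom_Icc[OF True] by simp
  have "ln (w1 0) - ln (w2 0) \<le> ln (w1 x) - ln (w2 x)"
  proof (rule nondecreasing_if_deriv_nonneg[OF x sub, where f="\<lambda>u. ln (w1 u) - ln (w2 u)"
        and f'="\<lambda>u. - (\<beta> u * (w1 u / tail_int w1 u)) - - (\<beta> u * (w2 u / tail_int w2 u))"])
    fix u assume "u \<in> {0..x}"
    then show "((\<lambda>u. ln (w1 u) - ln (w2 u)) has_real_derivative
        - (\<beta> u * (w1 u / tail_int w1 u)) - - (\<beta> u * (w2 u / tail_int w2 u))) (at u within beta_dom b)"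
      using sub by (intro DERIV_diff D1.ln_w0_deriv D2.ln_w0_deriv) auto
  next
    fix u assume "0 < u" "u < x"
    then have u: "u \<in> beta_dom b" using sub by auto
    have "w1 u / tail_int w1 u \<le> w2 u / tail_int w2 u"
      using m[OF u] D1.w0_pos[OF u] D2.w0_pos[OF u] D1.tail_pos[OF u] D2.tail_pos[OF u]
      by (simp add: field_simps)
    then have "\<beta> u * (w1 u / tail_int w1 u) \<le> \<beta> u * (w2 u / tail_int w2 u)"
      using \<beta>[OF u] by (rule mult_left_mono)
    then show "0 \<le> - (\<beta> u * (w1 u / tail_int w1 u)) - - (\<beta> u * (w2 u / tail_int w2 u))" by linarith
  qed
  then have "ln (w2 x / w2 0) \<le> ln (w1 x / w1 0)"
    using D1.w0_pos[OF True] D2.w0_pos[OF True] D1.w0_0_pos D2.w0_0_pos by (simp add: ln_div)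
  then show ?thesis
    using D1.w0_pos[OF True] D2.w0_pos[OF True] D1.w0_0_pos D2.w0_0_pos by (subst (asm) ln_le_cancel_iff) auto
next
  case False
  then show ?thesis using D1.w0_zero[OF x False] D2.w0_zero[OF x False] by simp
qed

end

lemma (in beta_data) beta_nonneg:
  assumes x: "x \<in> beta_dom b"
  shows "\<beta> x \<ge> 0"
proof -
  obtain y where y: "x < y" "y \<in> beta_dom b" using x by (rule dom_above)
  have x0: "0 \<le> x" using dom_nonneg[OF x] .
  have "(w0 has_real_derivative - (\<beta> x * (w0 x)\<^sup>2 / tail_int w0 x)) (at x within {x..y})"
    using w0_deriv[OF x] dom_Icc[OF y(2) x0] by (rule has_field_derivative_subset)
  then have "((\<lambda>u. (w0 u - w0 x) / (u - x)) \<longlongrightarrow> - (\<beta> x * (w0 x)\<^sup>2 / tail_int w0 x)) (at_right x)"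
    using y by (simp add: at_within_Icc_at_right has_field_derivative_iff)
  moreover have "eventually (\<lambda>u. (w0 u - w0 x) / (u - x) \<le> 0) (at_right x)"
  proof (rule eventually_at_rightI[of x "x + 1"])
    fix u assume "u \<in> {x<..<x+1}"
    then show "(w0 u - w0 x) / (u - x) \<le> 0" using w0_antimono[OF x0, of u] by (simp add: divide_le_0_iff)
  qed simp
  ultimately have "- (\<beta> x * (w0 x)\<^sup>2 / tail_int w0 x) \<le> 0"
    by (rule tendsto_upperbound) simp
  then show ?thesis using w0_pos[OF x] tail_pos[OF x] by (simp add: zero_le_divide_iff zero_le_mult_iff)
qed

context beta_data_pair
begin

text \<open>The normalized tails are ordered and have the same integral against
  \<open>x powr (-2/3)\<close>, so they agree almost everywhere. Since both data have unit mass,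
  integrating the normalized tails gives \<open>1 / w1 0 = 1 / w2 0\<close>.\<close>

lemma eq_if_ordered:
  assumes m: "\<And>u. u \<in> beta_dom b \<Longrightarrow> tail_int w2 u / w2 u \<le> tail_int w1 u / w1 u"
    and M1: "(LBINT x:{0<..}. x powr (-2/3) * w1 x) = 3 * w1 0"
    and M2: "(LBINT x:{0<..}. x powr (-2/3) * w2 x) = 3 * w2 0"
  shows "w1 0 = w2 0"
proof -
  \<comment> \<open>A non-integrable function would have integral 0 by convention, but here the
    integral is positive.\<close>
  have int: "integrable lborel (\<lambda>x. indicator {0<..} x * (x powr (-2/3) * w x))"
    if "(LBINT x:{0<..}. x powr (-2/3) * w x) = 3 * w 0" "w 0 > 0" for w :: "real \<Rightarrow> real"
    using that not_integrable_integral_eq[of lborel "\<lambda>x. indicator {0<..} x * (x powr (-2/3) * w x)"]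
    unfolding set_lebesgue_integral_def real_scaleR_def by fastforce
  note i1 = int[OF M1 D1.w0_0_pos] and i2 = int[OF M2 D2.w0_0_pos]
  define g where "g = (\<lambda>x. indicator {0<..} x * (x powr (-2/3) * w1 x) / w1 0
      - indicator {0<..} x * (x powr (-2/3) * w2 x) / w2 0)"
  have gi: "integrable lborel g"
    unfolding g_def using i1 i2 by (intro Bochner_Integration.integrable_diff integrable_divide)
  have "integral\<^sup>L lborel g = 0"
    unfolding g_def using i1 i2 M1 M2 D1.w0_0_pos D2.w0_0_pos
    by (subst Bochner_Integration.integral_diff) (auto simp: set_lebesgue_integral_def)
  moreover have g_eq: "g x = indicator {0<..} x * x powr (-2/3) * (w1 x / w1 0 - w2 x / w2 0)" for x
    by (simp add: g_def right_diff_distrib)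
  have "g x \<ge> 0" for x
    using tails_ordered[OF m D1.beta_nonneg, of x] unfolding g_eq by (cases "x > 0") auto
  ultimately have "AE x in lborel. g x = 0"
    using integral_nonneg_eq_0_iff_AE[OF gi] by auto
  then have "AE x in lborel. x \<noteq> 0 \<longrightarrow> indicator {0..} x * (w1 x / w1 0) = indicator {0..} x * (w2 x / w2 0)"
    by (rule AE_mp) (rule AE_I2, auto simp: g_eq indicator_def)
  then have "AE x in lborel. indicator {0..} x * (w1 x / w1 0) = indicator {0..} x * (w2 x / w2 0)"
    using AE_lborel_singleton[of 0] by eventually_elim simp
  moreover have "(\<lambda>x. indicator {0..} x * (w x / w 0)) \<in> borel_measurable lborel"
    if "lsw_initial_data w" for w
  proof -
    have "integrable lborel (\<lambda>x. (indicator {0..} x * w x) / w 0)"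
      using that unfolding lsw_initial_data_def set_integrable_def by (intro integrable_divide) simp
    then show ?thesis by (simp add: borel_measurable_integrable)
  qed
  ultimately have 1: "(\<integral>x. indicator {0..} x * (w1 x / w1 0) \<partial>lborel) = (\<integral>x. indicator {0..} x * (w2 x / w2 0) \<partial>lborel)"
    using D1.init D2.init by (intro integral_cong_AE) auto
  have 2: "(\<integral>x. indicator {0..} x * (w x / w 0) \<partial>lborel) = 1 / w 0" if "lsw_initial_data w" for w
    using that unfolding lsw_initial_data_def set_lebesgue_integral_def by simp
  have "1 / w1 0 = 1 / w2 0" using 1 unfolding 2[OF D1.init] 2[OF D2.init] .
  then show ?thesis by simp
qed

end

lemma initial_data_unique:
  assumes D1: "beta_data w1 \<mu>1 b \<beta>" and D2: "beta_data w2 \<mu>2 b \<beta>"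
    and M1: "(LBINT x:{0<..}. x powr (-2/3) * w1 x) = 3 * w1 0"
    and M2: "(LBINT x:{0<..}. x powr (-2/3) * w2 x) = 3 * w2 0"
    and x: "x \<ge> 0"
  shows "w1 x = w2 x"
proof -
  interpret D12: beta_data_pair w1 \<mu>1 w2 \<mu>2 b \<beta> using D1 D2 by (rule beta_data_pair.intro)
  interpret D21: beta_data_pair w2 \<mu>2 w1 \<mu>1 b \<beta> using D2 D1 by (rule beta_data_pair.intro)
  define c where "c = 1 / w1 0 - 1 / w2 0"
  \<comment> \<open>Both mean residual lives have derivative \<open>\<beta> - 1\<close>; at 0 they
    equal \<open>1 / w1 0\<close> and \<open>1 / w2 0\<close> because the total mass is 1.\<close>
  have const: "tail_int w1 u / w1 u - tail_int w2 u / w2 u = c" if u: "u \<in> beta_dom b" for u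
  proof -
    have sub: "{0..u} \<subseteq> beta_dom b" using D12.D1.dom_Icc[OF u] by simp
    have u0: "0 \<le> u" using D12.D1.dom_nonneg[OF u] .
    let ?f = "\<lambda>u. tail_int w1 u / w1 u - tail_int w2 u / w2 u"
    have d: "(?f has_real_derivative 0) (at v within beta_dom b)" if "v \<in> {0..u}" for v
    proof -
      have v: "v \<in> beta_dom b" using that sub by auto
      from DERIV_diff[OF D12.D1.mean_residual_deriv[OF v] D12.D2.mean_residual_deriv[OF v]]
      show ?thesis by simp
    qed
    have "?f 0 \<le> ?f u"
      by (rule nondecreasing_if_deriv_nonneg[OF u0 sub, where f="?f", OF d]) auto
    moreover have "- ?f 0 \<le> - ?f u"
    proof (rule nondecreasing_if_deriv_nonneg[OF u0 sub, where f="\<lambda>u. - ?f u" and f'="\<lambda>_. 0"])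
      fix v assume "v \<in> {0..u}"
      from DERIV_minus[OF d[OF this]] show "((\<lambda>u. - ?f u) has_real_derivative 0) (at v within beta_dom b)" by simp
    qed simp
    ultimately show ?thesis using D12.D1.tail_0 D12.D2.tail_0 by (simp add: c_def)
  qed
  \<comment> \<open>The sign of \<open>c\<close> decides which of the two mean residual lives is the
    larger.\<close>
  have "w1 0 = w2 0"
  proof (cases "c \<ge> 0")
    case True
    show ?thesis by (rule D12.eq_if_ordered[OF _ M1 M2]) (use const True in \<open>smt (verit)\<close>)
  next
    case False
    show ?thesis by (rule D21.eq_if_ordered[OF _ M2 M1, symmetric]) (use const False in \<open>smt (verit)\<close>)
  qed
  then have "c = 0" by (simp add: c_def)
  then have eq: "tail_int w1 u / w1 u = tail_int w2 u / w2 u" if "u \<in> beta_dom b" for u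
    using const[OF that] by simp
  have "w1 x / w1 0 = w2 x / w2 0"
    using D12.tails_ordered[OF _ D12.D1.beta_nonneg x] D21.tails_ordered[OF _ D12.D1.beta_nonneg x] eq
    by (metis order_antisym order_refl)
  then show ?thesis using \<open>w1 0 = w2 0\<close> D12.D2.w0_0_pos by simp
qed

text \<open>At time 0 the backward flow is the identity, so the formula for \<open>L\<close> becomes
  a moment condition on the data.\<close>

lemma moment_if_L_0:
  assumes "lsw_solution w0 w L" "L 0 = 1" "w0 0 > 0"
  shows "(LBINT x:{0<..}. x powr (-2/3) * w0 x) = 3 * w0 0"
proof -
  have w: "w x 0 = w0 x" if "x \<ge> 0" for x
    using assms(1) that unfolding lsw_solution_def lsw_characteristic_def by force
  have "root 3 (L 0) = (1/3) * (LBINT x:{0<..}. x powr (-2/3) * w x 0) / w 0 0"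
    using assms(1) unfolding lsw_solution_def by auto
  moreover have "(LBINT x:{0<..}. x powr (-2/3) * w x 0) = (LBINT x:{0<..}. x powr (-2/3) * w0 x)"
    by (intro set_lebesgue_integral_cong) (auto simp: w)
  ultimately show ?thesis using assms w[of 0] by (simp add: field_simps)
qed

theorem proposition5p2:
  fixes \<beta>\<^sub>0 :: "real \<Rightarrow> real" and b :: ereal
  assumes "bdd_above (\<beta>\<^sub>0 ` beta_dom b)"
    and "\<exists>l>0. ((\<beta>\<^sub>0 \<circ> real_of_ereal) \<longlongrightarrow> l) (at_left b)"
  shows "\<exists>C>0. \<forall>w\<^sub>0 \<mu>\<^sub>0 w L.
           lsw_initial_data w\<^sub>0 \<longrightarrow>
           associated_law w\<^sub>0 \<mu>\<^sub>0 \<longrightarrow> sup_norm \<mu>\<^sub>0 = b \<longrightarrow> is_beta_function w\<^sub>0 b \<beta>\<^sub>0 \<longrightarrow>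
           lsw_solution w\<^sub>0 w L \<longrightarrow> L 0 = 1 \<longrightarrow>
           (\<forall>T\<ge>1. mean_volume w T \<ge> C * T)"
proof (cases "\<exists>w\<^sub>0 \<mu>\<^sub>0 w L. beta_data w\<^sub>0 \<mu>\<^sub>0 b \<beta>\<^sub>0 \<and> lsw_solution w\<^sub>0 w L \<and> L 0 = 1")
  \<comment> \<open>No admissible data with a solution exist, the claim is vacuous and any positive
    constant will do.\<close>
  case False
  then have "\<not> (lsw_initial_data w\<^sub>0 \<and> associated_law w\<^sub>0 \<mu>\<^sub>0 \<and> sup_norm \<mu>\<^sub>0 = b \<and> is_beta_function w\<^sub>0 b \<beta>\<^sub>0 \<and>
      lsw_solution w\<^sub>0 w L \<and> L 0 = 1)" for w\<^sub>0 \<mu>\<^sub>0 w L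
    unfolding beta_data_def by blast
  then show ?thesis by (intro exI[of _ 1]) auto
next
  case True
  \<comment> \<open>One admissible datum \<open>u\<close> is fixed to define the constant; by
    uniqueness every other one coincides with it on the half line.\<close>
  then obtain u \<mu> wu Lu where D: "beta_data u \<mu> b \<beta>\<^sub>0" and sol: "lsw_solution u wu Lu" "Lu 0 = 1" by blast
  interpret beta_data u \<mu> b \<beta>\<^sub>0 by (rule D)
  obtain B0 where B0: "\<And>x. x \<in> beta_dom b \<Longrightarrow> \<beta>\<^sub>0 x \<le> B0" using assms(1) unfolding bdd_above_def by auto
  define B where "B = max B0 0"
  have B: "\<And>x. x \<in> beta_dom b \<Longrightarrow> \<beta>\<^sub>0 x \<le> B" "B \<ge> 0" using B0 by (auto simp: B_def le_max_iff_disj)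
  obtain l where l: "l > 0" "((\<beta>\<^sub>0 \<circ> real_of_ereal) \<longlongrightarrow> l) (at_left b)" using assms(2) by blast
  \<comment> \<open>Half of the limit, hence a positive lower bound for the beta function near the
    end point.\<close>
  define a where "a = l / 2"
  have a: "a > 0" "a < l" using l by (auto simp: a_def)
  have b0: "0 < b" using zero_in_dom by (simp add: beta_dom_def zero_ereal_def)
  have "eventually (\<lambda>y. a < (\<beta>\<^sub>0 \<circ> real_of_ereal) y) (at_left b)"
    using order_tendstoD(1)[OF l(2) a(2)] .
  then obtain c where c: "c < b" "\<And>y. c < y \<Longrightarrow> y < b \<Longrightarrow> a < \<beta>\<^sub>0 (real_of_ereal y)"
    unfolding eventually_at_left[OF b0] by auto
  have "max 0 c < b" using b0 c(1) by simp
  then obtain x1 where x1: "max 0 c < ereal x1" "ereal x1 < b" using ereal_dense2 by blast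
  have x1_dom: "x1 \<in> beta_dom b" using x1 by (simp add: beta_dom_def zero_ereal_def)
  have a_le: "a \<le> \<beta>\<^sub>0 y" if "y \<in> beta_dom b" "y \<ge> x1" for y
  proof -
    have "c < ereal y" using x1 that by (meson ereal_less_eq(3) le_less_trans less_le_trans max.cobounded2)
    then show ?thesis using c(2)[of "ereal y"] that by (simp add: beta_dom_def)
  qed
  \<comment> \<open>The chain starts at \<open>x1\<close>, from where on the beta function is at
    least \<open>a\<close>.\<close>
  define z where "z = rec_nat x1 (\<lambda>_ v. v + tail_int u v / (2 * u v))"
  have z_0: "z 0 = x1" and z_Suc: "z (Suc j) = z j + tail_int u (z j) / (2 * u (z j))" for j
    by (simp_all add: z_def)
  define \<kappa> where "\<kappa> = 2 powr (- B)"
  define \<theta> where "\<theta> = (1 - \<kappa> / 2) powr a"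
  have \<kappa>: "0 < \<kappa>" "\<kappa> \<le> 1" using B(2) powr_mono[of "- B" 0 "2::real"] by (auto simp: \<kappa>_def)
  have "(1 - \<kappa> / 2) powr a < 1 powr a" using \<kappa> a by (intro powr_less_mono2) auto
  then have \<theta>: "0 < \<theta>" "\<theta> < 1" using \<kappa> by (auto simp: \<theta>_def)
  have z: "z j \<in> beta_dom b \<and> x1 \<le> z j" for j
  proof (induction j)
    case (Suc j)
    then show ?case using half_step(1,2)[OF _ B _ a(1) z_Suc[of j]] a_le by fastforce
  qed (simp add: z_0 x1_dom)
  have w_ge: "\<kappa> * u (z j) \<le> u (z (Suc j))" and w_le: "u (z (Suc j)) \<le> \<theta> * u (z j)" for j
    using half_step(3,4)[OF _ B _ a(1) z_Suc[of j]] a_le z[of j] unfolding \<kappa>_def \<theta>_def by fastforce+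
  have w_pos: "u (z j) > 0" for j using w0_pos z by blast
  \<comment> \<open>Geometric decay along the chain excludes a jump of \<open>u\<close> at the end
    point, which gives the continuity required for the mean volume.\<close>
  have small: "\<exists>v\<in>beta_dom b. u v < e" if "e > 0" for e
  proof -
    have pow: "u (z j) \<le> \<theta> ^ j * u (z 0)" for j
    proof (induction j)
      case (Suc j)
      have "u (z (Suc j)) \<le> \<theta> * u (z j)" by (rule w_le)
      also have "\<dots> \<le> \<theta> * (\<theta> ^ j * u (z 0))" using Suc \<theta> by (intro mult_left_mono) auto
      finally show ?case by simp
    qed simp
    have "(\<lambda>j. \<theta> ^ j * u (z 0)) \<longlonglongrightarrow> 0 * u (z 0)"
      using \<theta> by (intro tendsto_mult LIMSEQ_realpow_zero tendsto_const) auto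
    then have "eventually (\<lambda>j. \<theta> ^ j * u (z 0) < e) sequentially"
      using that by (intro order_tendstoD(2)[where y="0 * u (z 0)"]) auto
    then obtain J where "\<theta> ^ J * u (z 0) < e" by (auto simp: eventually_sequentially)
    then show ?thesis using pow[of J] z[of J] by (intro bexI[of _ "z J"]) auto
  qed
  define K where "K = \<bar>6 / u (z 2) * ln (1 / (u (z 2) * (z 2 - z 1)))\<bar> * u 0
      + 6 * \<bar>ln (30 * exp (15 / \<kappa>^3) / (\<kappa> * \<kappa>^3))\<bar> / \<kappa>\<^sup>2 / (1 - \<theta>)"
  have K0: "K \<ge> 0"
    unfolding K_def using w0_0_pos \<theta> by (intro add_nonneg_nonneg mult_nonneg_nonneg divide_nonneg_nonneg) auto
  note moment_u = moment_if_L_0[OF sol w0_0_pos]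
  \<comment> \<open>Using \<open>K + 1\<close> keeps the denominator positive also when
    \<open>K = 0\<close>.\<close>
  have "1 / (K + 1) * T \<le> mean_volume w T"
    if hyp: "beta_data v \<mu>' b \<beta>\<^sub>0" "lsw_solution v w L" "L 0 = 1" and T: "T \<ge> 1" for v \<mu>' w L T
  proof -
    interpret V: beta_data v \<mu>' b \<beta>\<^sub>0 by (rule hyp(1))
    interpret S: lsw_sol v w L by unfold_locales (rule V.init, rule hyp(2))
    have eq: "v x = u x" if "x \<ge> 0" for x
      using initial_data_unique[OF hyp(1) D moment_if_L_0[OF hyp(2,3) V.w0_0_pos] moment_u that] .
    have tail_eq: "tail_int v x = tail_int u x" if "x \<ge> 0" for x
      unfolding tail_int_def by (intro set_lebesgue_integral_cong) (use that eq in auto)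
    have zn: "z j \<ge> 0" for j using z dom_nonneg by blast
    have T0: "T \<ge> 0" using T by simp
    have "T * w 0 T \<le> K"
      unfolding K_def eq[OF zn, symmetric] eq[OF order_refl, symmetric]
      by (rule S.growth_from_chain[OF zn _ _ \<kappa> \<theta> _ _ T0])
        (simp_all only: eq[OF zn] tail_eq[OF zn] z_Suc[symmetric] w_pos w_ge w_le)
    have "\<exists>x\<in>beta_dom b. v x < e" if "e > 0" for e
      using small[OF that] eq dom_nonneg by auto
    from S.mean_volume_eq[OF T0 V.w0_continuous[OF this] V.w0_differentiable]
    have mv: "mean_volume w T = 1 / w 0 T" .
    have "w 0 T > 0" using S.w_0_pos[OF T0] .
    moreover have "T * w 0 T \<le> K + 1" using \<open>T * w 0 T \<le> K\<close> by simp
    ultimately show ?thesis unfolding mv using K0 by (simp add: field_simps)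
  qed
  moreover have "1 / (K + 1) > 0" using K0 by simp
  ultimately show ?thesis unfolding beta_data_def by blast
qed

end
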